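(* Let $n\geq 1$, let $\alpha$ be a composition of $n$ and let $E\in\mathcal E(\alpha)$ be an equivalence class of standard composition tableaux of shape $\alpha$. Then $\operatorname{End}_{H_n(0)}(\mathbf S_{\alpha,E})=\mathbb C\,\mathrm{id}$. In particular, $\mathbf S_{\alpha,E}$ is an indecomposable $H_n(0)$-module.
   Context: The 0-Hecke algebra $H_n(0)$ is the unital associative $\mathbb C$-algebra generated by $\pi_1,\dots,\pi_{n-1}$ subject to $\pi_i^2=\pi_i$, $\pi_i\pi_{i+1}\pi_i=\pi_{i+1}\pi_i\pi_{i+1}$, and $\pi_i\pi_j=\pi_j\pi_i$ for $|i-j|\ge 2$. A composition $\alpha=(\alpha_1,\dots,\alpha_l)$ of $n$ is a sequence of positive integers with sum $n$. Its diagram is $\{(i,j)\in\mathbb N^2: i\le l,\ j\le\alpha_i\}$, drawn in matrix coordinates (row $1$ on top, row $i$ has $\alpha_i$ cells). A standard composition tableau (SCT) of shape $\alpha$ is a bijection $T$ from the diagram of $\alpha$ to $[n]=\{1,\dots,n\}$ such that: (1) entries decrease along each row from left to right; (2) entries of the first column increase from top to bottom; (3) (triple rule) if $(j,k)$ and $(i,k-1)$ are cells of $\alpha$ with $j>i$ and $T(j,k)<T(i,k-1)$, then $(i,k)$ is a cell of $\alpha$ and $T(j,k)<T(i,k)$. Let $\mathrm{SCT}(\alpha)$ be the set of these. For an entry $k$ of $T$ let $c_T(k)$ be the column of the cell $T^{-1}(k)$. A cell $(i,j)$ attacks a cell $(i',j')$ if either $j=j'$ and $i\ne i'$, or $j=j'-1$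 and $i<i'$; entry $a$ attacks entry $b$ in $T$ if $T^{-1}(a)$ attacks $T^{-1}(b)$. Define $D(T)=\{i\in[n-1]: c_T(i)\le c_T(i+1)\}$, $AD(T)=\{i\in D(T): i \text{ attacks } i+1 \text{ in } T\}$, $nAD(T)=D(T)\setminus AD(T)$. The space $\mathbf S_\alpha=\operatorname{span}_{\mathbb C}\mathrm{SCT}(\alpha)$ is an $H_n(0)$-module via $\pi_iT=T$ if $i\notin D(T)$, $\pi_iT=0$ if $i\in AD(T)$, and $\pi_iT=s_iT$ if $i\in nAD(T)$, where $s_iT$ is obtained from $T$ by interchanging the entries $i$ and $i+1$ (it is again an SCT). Two tableaux $T_1,T_2\in\mathrm{SCT}(\alpha)$ are equivalent, $T_1\sim T_2$, if in each column the relative order of the entries of $T_1$ coincides with that of $T_2$. $\mathcal E(\alpha)$ denotes the set of equivalence classes, and for $E\in\mathcal E(\alpha)$, $\mathbf S_{\alpha,E}=\operatorname{span}_{\mathbb C}E$, which is an $H_n(0)$-submodule of $\mathbf S_\alpha$. *)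

theory Defs
  imports
    Complex_Main
    "HOL-Library.Poly_Mapping"
    "HOL-Library.FuncSet"
    "HOL-Combinatorics.Transposition"
    "HOL-Algebra.QuotRing"
    "HOL-Algebra.Module"
begin

section \<open>Formal complex linear combinations\<close>

definition cscale :: "complex \<Rightarrow> ('a \<Rightarrow>\<^sub>0 complex) \<Rightarrow> ('a \<Rightarrow>\<^sub>0 complex)" where
  "cscale c v = Poly_Mapping.map (\<lambda>z. c * z) v"

definition lin_ext :: "('a \<Rightarrow> ('b \<Rightarrow>\<^sub>0 complex)) \<Rightarrow> ('a \<Rightarrow>\<^sub>0 complex) \<Rightarrow> ('b \<Rightarrow>\<^sub>0 complex)" where
  "lin_ext f v = (\<Sum>b\<in>Poly_Mapping.keys v. cscale (Poly_Mapping.lookup v b) (f b))"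


section \<open>The 0-Hecke algebra\<close>

text \<open>Words form the free monoid, written additively because \<^typ>\<open>'a \<Rightarrow>\<^sub>0 'b\<close> is
  the monoid algebra of an additive monoid. Hence \<open>word \<Rightarrow>\<^sub>0 complex\<close> is the free associative
  unital algebra on generators indexed by the natural numbers.\<close>

datatype word = Word (letters: "nat list")

instantiation word :: monoid_add
begin

definition zero_word :: word where "0 = Word []"

definition plus_word :: "word \<Rightarrow> word \<Rightarrow> word" where
  "u + v = Word (letters u @ letters v)"

instance
  by standard (simp_all add: zero_word_def plus_word_def)

end

definition free_alg :: "nat \<Rightarrow> (word \<Rightarrow>\<^sub>0 complex) ring" where
  "free_alg n =
    \<lparr>carrier = {p. \<forall>w\<in>Poly_Mapping.keys p. set (letters w) \<subseteq> {1..<n}},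
     mult = (*), one = 1, zero = 0, add = (+)\<rparr>"

definition gen :: "nat \<Rightarrow> (word \<Rightarrow>\<^sub>0 complex)" where
  "gen i = Poly_Mapping.single (Word [i]) 1"

definition hecke_rels :: "nat \<Rightarrow> (word \<Rightarrow>\<^sub>0 complex) set" where
  "hecke_rels n =
     {gen i * gen i - gen i | i. i \<in> {1..<n}} \<union>
     {gen i * gen (i + 1) * gen i - gen (i + 1) * gen i * gen (i + 1)
       | i. i \<in> {1..<n} \<and> i + 1 \<in> {1..<n}} \<union>
     {gen i * gen j - gen j * gen i
       | i j. i \<in> {1..<n} \<and> j \<in> {1..<n} \<and> \<bar>int i - int j\<bar> \<ge> 2}"

text \<open>\<^const>\<open>genideal\<close> is the two-sided ideal generated by a set; it is closed under complex
  scalars since these lie in \<^term>\<open>carrier (free_alg n)\<close>.\<close>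

definition hecke0 :: "nat \<Rightarrow> (word \<Rightarrow>\<^sub>0 complex) set ring" where
  "hecke0 n = free_alg n Quot (Idl\<^bsub>free_alg n\<^esub> (hecke_rels n))"


section \<open>Left modules over a not necessarily commutative ring\<close>

text \<open>The locale \<^locale>\<open>module\<close> of HOL-Algebra requires a commutative ring; the axioms
  below are the same without commutativity. As there, the fields \<^const>\<open>mult\<close> and
  \<^const>\<open>one\<close> of the module record are irrelevant.\<close>

locale left_module = R?: ring R + M?: abelian_group M
  for R :: "('a, 'r) ring_scheme" (structure) and M :: "('a, 'b, 'm) module_scheme" (structure) +
  assumes smult_closed:
      "\<lbrakk>a \<in> carrier R; x \<in> carrier M\<rbrakk> \<Longrightarrow> a \<odot>\<^bsub>M\<^esub> x \<in> carrier M"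
    and smult_l_distr:
      "\<lbrakk>a \<in> carrier R; b \<in> carrier R; x \<in> carrier M\<rbrakk> \<Longrightarrow>
       (a \<oplus>\<^bsub>R\<^esub> b) \<odot>\<^bsub>M\<^esub> x = a \<odot>\<^bsub>M\<^esub> x \<oplus>\<^bsub>M\<^esub> b \<odot>\<^bsub>M\<^esub> x"
    and smult_r_distr:
      "\<lbrakk>a \<in> carrier R; x \<in> carrier M; y \<in> carrier M\<rbrakk> \<Longrightarrow>
       a \<odot>\<^bsub>M\<^esub> (x \<oplus>\<^bsub>M\<^esub> y) = a \<odot>\<^bsub>M\<^esub> x \<oplus>\<^bsub>M\<^esub> a \<odot>\<^bsub>M\<^esub> y"
    and smult_assoc1:
      "\<lbrakk>a \<in> carrier R; b \<in> carrier R; x \<in> carrier M\<rbrakk> \<Longrightarrow>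
       (a \<otimes>\<^bsub>R\<^esub> b) \<odot>\<^bsub>M\<^esub> x = a \<odot>\<^bsub>M\<^esub> (b \<odot>\<^bsub>M\<^esub> x)"
    and smult_one:
      "x \<in> carrier M \<Longrightarrow> \<one>\<^bsub>R\<^esub> \<odot>\<^bsub>M\<^esub> x = x"

text \<open>Endomorphisms are extensional functions, so that they are determined by their values
  on the carrier.\<close>

definition module_End ::
  "('a, 'r) ring_scheme \<Rightarrow> ('a, 'b, 'm) module_scheme \<Rightarrow> ('b \<Rightarrow> 'b) set" where
  "module_End R M =
    {f \<in> carrier M \<rightarrow>\<^sub>E carrier M.
       (\<forall>x\<in>carrier M. \<forall>y\<in>carrier M. f (x \<oplus>\<^bsub>M\<^esub> y) = f x \<oplus>\<^bsub>M\<^esub> f y) \<and>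
       (\<forall>a\<in>carrier R. \<forall>x\<in>carrier M. f (a \<odot>\<^bsub>M\<^esub> x) = a \<odot>\<^bsub>M\<^esub> f x)}"

definition indecomposable_module ::
  "('a, 'r) ring_scheme \<Rightarrow> ('a, 'b, 'm) module_scheme \<Rightarrow> bool" where
  "indecomposable_module R M \<longleftrightarrow>
     left_module R M \<and> carrier M \<noteq> {\<zero>\<^bsub>M\<^esub>} \<and>
     (\<forall>U W. submodule U R M \<and> submodule W R M \<and>
        U \<inter> W = {\<zero>\<^bsub>M\<^esub>} \<and> U <+>\<^bsub>M\<^esub> W = carrier M \<longrightarrow>
        U = {\<zero>\<^bsub>M\<^esub>} \<or> W = {\<zero>\<^bsub>M\<^esub>})"


section \<open>Standard composition tableaux\<close>

definition compositions :: "nat \<Rightarrow> nat list set" where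
  "compositions n = {\<alpha>. (\<forall>a\<in>set \<alpha>. 1 \<le> a) \<and> sum_list \<alpha> = n}"

text \<open>Rows and columns are numbered from 1, list positions from 0.\<close>

definition diagram :: "nat list \<Rightarrow> (nat \<times> nat) set" where
  "diagram \<alpha> = {(i, j). 1 \<le> i \<and> i \<le> length \<alpha> \<and> 1 \<le> j \<and> j \<le> \<alpha> ! (i - 1)}"

type_synonym tableau = "nat \<times> nat \<Rightarrow> nat"

definition SCT :: "nat list \<Rightarrow> tableau set" where
  "SCT \<alpha> = {T \<in> diagram \<alpha> \<rightarrow>\<^sub>E {1..sum_list \<alpha>}.
     bij_betw T (diagram \<alpha>) {1..sum_list \<alpha>} \<and>
     (\<forall>i j k. (i, j) \<in> diagram \<alpha> \<and> (i, k) \<in> diagram \<alpha> \<and> j < k \<longrightarrow> T (i, k) < T (i, j)) \<and>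
     (\<forall>i j. (i, 1) \<in> diagram \<alpha> \<and> (j, 1) \<in> diagram \<alpha> \<and> i < j \<longrightarrow> T (i, 1) < T (j, 1)) \<and>
     (\<forall>i j k. (j, k) \<in> diagram \<alpha> \<and> (i, k - 1) \<in> diagram \<alpha> \<and> i < j \<and> T (j, k) < T (i, k - 1) \<longrightarrow>
        (i, k) \<in> diagram \<alpha> \<and> T (j, k) < T (i, k))}"

definition cell_of :: "nat list \<Rightarrow> tableau \<Rightarrow> nat \<Rightarrow> nat \<times> nat" where
  "cell_of \<alpha> T k = the_inv_into (diagram \<alpha>) T k"

definition col_of :: "nat list \<Rightarrow> tableau \<Rightarrow> nat \<Rightarrow> nat" where
  "col_of \<alpha> T k = snd (cell_of \<alpha> T k)"

fun attacks :: "nat \<times> nat \<Rightarrow> nat \<times> nat \<Rightarrow> bool" where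
  "attacks (i, j) (i', j') \<longleftrightarrow> (j = j' \<and> i \<noteq> i') \<or> (j + 1 = j' \<and> i < i')"

definition Des :: "nat list \<Rightarrow> tableau \<Rightarrow> nat set" where
  "Des \<alpha> T = {i \<in> {1..<sum_list \<alpha>}. col_of \<alpha> T i \<le> col_of \<alpha> T (i + 1)}"

definition ADes :: "nat list \<Rightarrow> tableau \<Rightarrow> nat set" where
  "ADes \<alpha> T = {i \<in> Des \<alpha> T. attacks (cell_of \<alpha> T i) (cell_of \<alpha> T (i + 1))}"

definition nADes :: "nat list \<Rightarrow> tableau \<Rightarrow> nat set" where
  "nADes \<alpha> T = Des \<alpha> T - ADes \<alpha> T"

definition swap_entries :: "nat list \<Rightarrow> nat \<Rightarrow> tableau \<Rightarrow> tableau" where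
  "swap_entries \<alpha> i T = (\<lambda>c\<in>diagram \<alpha>. transpose i (i + 1) (T c))"

definition sct_equiv :: "nat list \<Rightarrow> (tableau \<times> tableau) set" where
  "sct_equiv \<alpha> = {(T\<^sub>1, T\<^sub>2). T\<^sub>1 \<in> SCT \<alpha> \<and> T\<^sub>2 \<in> SCT \<alpha> \<and>
     (\<forall>i j k. (i, k) \<in> diagram \<alpha> \<and> (j, k) \<in> diagram \<alpha> \<longrightarrow>
        (T\<^sub>1 (i, k) < T\<^sub>1 (j, k) \<longleftrightarrow> T\<^sub>2 (i, k) < T\<^sub>2 (j, k)))}"

definition sct_classes :: "nat list \<Rightarrow> tableau set set" where
  "sct_classes \<alpha> = SCT \<alpha> // sct_equiv \<alpha>"


section \<open>The modules spanned by standard composition tableaux\<close>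

definition pi_tab :: "nat list \<Rightarrow> nat \<Rightarrow> tableau \<Rightarrow> (tableau \<Rightarrow>\<^sub>0 complex)" where
  "pi_tab \<alpha> i T =
     (if i \<in> ADes \<alpha> T then 0
      else if i \<in> nADes \<alpha> T then Poly_Mapping.single (swap_entries \<alpha> i T) 1
      else Poly_Mapping.single T 1)"

definition pi_op :: "nat list \<Rightarrow> nat \<Rightarrow> (tableau \<Rightarrow>\<^sub>0 complex) \<Rightarrow> (tableau \<Rightarrow>\<^sub>0 complex)" where
  "pi_op \<alpha> i = lin_ext (pi_tab \<alpha> i)"

definition free_act ::
  "nat list \<Rightarrow> (word \<Rightarrow>\<^sub>0 complex) \<Rightarrow> (tableau \<Rightarrow>\<^sub>0 complex) \<Rightarrow> (tableau \<Rightarrow>\<^sub>0 complex)" where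
  "free_act \<alpha> p v = lin_ext (\<lambda>w. foldr (pi_op \<alpha>) (letters w) v) p"

text \<open>An element of \<^const>\<open>hecke0\<close> is a coset \<open>X\<close> of elements of the free algebra; it acts as
  any of its representatives does. On \<open>span SCT(\<alpha>)\<close> this does not depend on the representative,
  because the operators \<^term>\<open>pi_op \<alpha> i\<close> satisfy the defining relations there.\<close>

definition S_module ::
  "nat list \<Rightarrow> tableau set \<Rightarrow> ((word \<Rightarrow>\<^sub>0 complex) set, tableau \<Rightarrow>\<^sub>0 complex) module" where
  "S_module \<alpha> E =
    \<lparr>carrier = {v. Poly_Mapping.keys v \<subseteq> E},
     mult = undefined, one = undefined, zero = 0, add = (+),
     smult = (\<lambda>X v. the_elem ((\<lambda>p. free_act \<alpha> p v) ` X))\<rparr>"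

end

theory Submission
  imports Defs
begin

text \<open>Every equivalence class contains a unique source tableau \<open>S\<close>, in which each non-descent \<open>i\<close>
  is the right neighbour of \<open>i + 1\<close>, and \<open>S\<close> generates the module. Let \<open>v\<close> be the image of \<open>S\<close>
  under an endomorphism. The equations \<open>\<pi>\<^sub>i v = v\<close> for the non-descents \<open>i\<close> of \<open>S\<close> force every \<open>T\<close>
  in the support of \<open>v\<close> to have \<open>D(T) \<subseteq> D(S)\<close>. For such a \<open>T \<noteq> S\<close> let \<open>k\<close> be the last entry in whose
  position \<open>S\<close> and \<open>T\<close> differ, and \<open>j\<close> the first later entry that \<open>k\<close> attacks in \<open>S\<close>. Then
  \<open>\<pi>\<^bsub>j-1\<^esub> \<dots> \<pi>\<^bsub>k\<^esub>\<close> annihilates \<open>S\<close>, whereas in \<open>T\<close> every factor acts by a proper interchange. If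
  \<open>T \<noteq> S\<close> has the maximal number of inversions in the support, its coefficient survives in the image
  \<open>0\<close> of \<open>v\<close> under this product, a contradiction. Hence \<open>v\<close> is a multiple of \<open>S\<close>.\<close>

subsection \<open>Formal linear combinations\<close>

lemma lookup_cscale [simp]: "Poly_Mapping.lookup (cscale c v) x = c * Poly_Mapping.lookup v x"
  by (simp add: cscale_def Poly_Mapping.map.rep_eq when_def)

interpretation formal: vector_space "cscale :: complex \<Rightarrow> ('a \<Rightarrow>\<^sub>0 complex) \<Rightarrow> ('a \<Rightarrow>\<^sub>0 complex)"
  by unfold_locales (auto intro!: poly_mapping_eqI simp: lookup_add algebra_simps)

interpretation formal_pair: vector_space_pair
  "cscale :: complex \<Rightarrow> ('a \<Rightarrow>\<^sub>0 complex) \<Rightarrow> ('a \<Rightarrow>\<^sub>0 complex)"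
  "cscale :: complex \<Rightarrow> ('b \<Rightarrow>\<^sub>0 complex) \<Rightarrow> ('b \<Rightarrow>\<^sub>0 complex)"
  by unfold_locales

abbreviation clinear :: "(('a \<Rightarrow>\<^sub>0 complex) \<Rightarrow> ('b \<Rightarrow>\<^sub>0 complex)) \<Rightarrow> bool" where
  "clinear \<equiv> Vector_Spaces.linear cscale cscale"

abbreviation basis :: "'a \<Rightarrow> ('a \<Rightarrow>\<^sub>0 complex)" where
  "basis x \<equiv> Poly_Mapping.single x 1"

abbreviation formal_span :: "'a set \<Rightarrow> ('a \<Rightarrow>\<^sub>0 complex) set" where
  "formal_span S \<equiv> formal.span (basis ` S)"

lemmas clinear_compose = Vector_Spaces.linear_compose[unfolded comp_def]

lemma clinearI:
  assumes "\<And>u v. g (u + v) = g u + g v" and "\<And>c v. g (cscale c v) = cscale c (g v)"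
  shows "clinear g"
  by unfold_locales (fact assms)+

lemma keys_cscale: "Poly_Mapping.keys (cscale c v) \<subseteq> Poly_Mapping.keys v"
  by (auto simp: in_keys_iff)

lemma lin_ext_superset:
  assumes "finite S" "Poly_Mapping.keys v \<subseteq> S"
  shows "lin_ext f v = (\<Sum>b\<in>S. cscale (Poly_Mapping.lookup v b) (f b))"
  unfolding lin_ext_def using assms
  by (intro sum.mono_neutral_left) (auto simp: in_keys_iff)

lemma clinear_lin_ext: "clinear (lin_ext f)"
proof (rule clinearI)
  fix u v :: "'a \<Rightarrow>\<^sub>0 complex" and c :: complex
  let ?S = "Poly_Mapping.keys u \<union> Poly_Mapping.keys v"
  have "lin_ext f (u + v) = (\<Sum>b\<in>?S. cscale (Poly_Mapping.lookup (u + v) b) (f b))"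
    using keys_add[of u v] by (intro lin_ext_superset) auto
  also have "\<dots> = lin_ext f u + lin_ext f v"
    by (simp add: lookup_add formal.scale_left_distrib sum.distrib lin_ext_superset[of ?S])
  finally show "lin_ext f (u + v) = lin_ext f u + lin_ext f v" .
  have "lin_ext f (cscale c v) =
      (\<Sum>b\<in>Poly_Mapping.keys v. cscale (Poly_Mapping.lookup (cscale c v) b) (f b))"
    using keys_cscale[of c v] by (intro lin_ext_superset) auto
  then show "lin_ext f (cscale c v) = cscale c (lin_ext f v)"
    by (simp add: lin_ext_def formal.scale_sum_right)
qed

lemma lin_ext_single [simp]: "lin_ext f (Poly_Mapping.single b c) = cscale c (f b)"
  by (simp add: lin_ext_def)

lemma formal_span_iff: "v \<in> formal_span S \<longleftrightarrow> Poly_Mapping.keys v \<subseteq> S"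
proof
  have "formal.subspace {v. Poly_Mapping.keys v \<subseteq> S}"
    by (intro formal.subspaceI) (auto dest: subsetD[OF keys_add] subsetD[OF keys_cscale])
  then have "formal_span S \<subseteq> {v. Poly_Mapping.keys v \<subseteq> S}"
    by (intro formal.span_minimal) auto
  then show "v \<in> formal_span S \<Longrightarrow> Poly_Mapping.keys v \<subseteq> S"
    by blast
next
  assume keys: "Poly_Mapping.keys v \<subseteq> S"
  have "v = (\<Sum>b\<in>Poly_Mapping.keys v. cscale (Poly_Mapping.lookup v b) (basis b))"
    by (rule poly_mapping_eqI)
      (auto simp: lookup_sum lookup_single when_def in_keys_iff if_distrib[of "\<lambda>z. _ * z"]
        cong: if_cong)
  moreover have "\<dots> \<in> formal_span S"
    using keys by (intro formal.span_sum formal.span_scale formal.span_base) auto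
  ultimately show "v \<in> formal_span S"
    by simp
qed

lemma basis_in_formal_span: "b \<in> S \<Longrightarrow> basis b \<in> formal_span S"
  by (simp add: formal.span_base)

lemma formal_span_mono: "S \<subseteq> S' \<Longrightarrow> formal_span S \<subseteq> formal_span S'"
  by (intro formal.span_mono image_mono)

lemma clinear_eq_on_formal_span:
  assumes "clinear g" "clinear h" "v \<in> formal_span S"
    and "\<And>b. b \<in> S \<Longrightarrow> g (basis b) = h (basis b)"
  shows "g v = h v"
  using formal_pair.linear_eq_on[OF assms(1-3)] assms(4) by blast

lemma clinear_maps_formal_span:
  assumes "clinear g" "v \<in> formal_span S"
    and "\<And>b. b \<in> S \<Longrightarrow> g (basis b) \<in> formal_span S'"
  shows "g v \<in> formal_span S'"
proof -
  have "formal_span S \<subseteq> {v. g v \<in> formal_span S'}"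
    using assms formal_pair.linear_subspace_linear_preimage[OF assms(1) formal.subspace_span]
    by (intro formal.span_minimal) auto
  then show ?thesis
    using assms(2) by blast
qed

lemma lin_ext_eq_on_formal_span:
  assumes add: "\<And>u v. \<lbrakk>u \<in> formal_span S; v \<in> formal_span S\<rbrakk> \<Longrightarrow> f (u + v) = f u + f v"
    and scale: "\<And>c v. v \<in> formal_span S \<Longrightarrow> f (cscale c v) = cscale c (f v)"
    and "v \<in> formal_span S"
  shows "lin_ext (\<lambda>b. f (basis b)) v = f v"
proof -
  let ?F = "lin_ext (\<lambda>b. f (basis b))"
  have "f 0 = 0"
    using scale[OF formal.span_zero, of 0] by simp
  then have "formal.subspace {v \<in> formal_span S. ?F v = f v}"
    by (intro formal.subspaceI)
      (simp_all add: add scale formal.span_zero formal.span_add formal.span_scale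
        formal_pair.linear_0[OF clinear_lin_ext] formal_pair.linear_add[OF clinear_lin_ext]
        formal_pair.linear_scale[OF clinear_lin_ext])
  then have "formal_span S \<subseteq> {v \<in> formal_span S. ?F v = f v}"
    by (intro formal.span_minimal) (auto simp: formal.span_base)
  then show ?thesis
    using assms(3) by blast
qed

subsection \<open>Idempotent endomorphisms and indecomposability\<close>

context left_module
begin

lemma direct_sum_component_unique:
  assumes sub: "submodule U R M" "submodule W R M" and "U \<inter> W = {\<zero>\<^bsub>M\<^esub>}"
    and mem: "u \<in> U" "u' \<in> U" "w \<in> W" "w' \<in> W" and eq: "u \<oplus>\<^bsub>M\<^esub> w = u' \<oplus>\<^bsub>M\<^esub> w'"
  shows "u = u'"
proof -
  interpret U: submodule U R M by (rule sub)
  interpret W: submodule W R M by (rule sub)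
  have closed: "u \<in> carrier M" "u' \<in> carrier M" "w \<in> carrier M" "w' \<in> carrier M"
    using mem U.subset W.subset by auto
  have "u \<ominus>\<^bsub>M\<^esub> u' = w' \<ominus>\<^bsub>M\<^esub> w"
  proof -
    have "w' = \<ominus>\<^bsub>M\<^esub> u' \<oplus>\<^bsub>M\<^esub> (u \<oplus>\<^bsub>M\<^esub> w)"
      using eq closed by (simp add: M.r_neg1)
    then have "w' \<ominus>\<^bsub>M\<^esub> w = \<ominus>\<^bsub>M\<^esub> u' \<oplus>\<^bsub>M\<^esub> u"
      using closed by (simp add: M.minus_eq M.a_assoc M.r_neg)
    then show ?thesis
      using closed by (simp add: M.minus_eq M.a_comm)
  qed
  moreover have "u \<ominus>\<^bsub>M\<^esub> u' \<in> U"
    using mem U.m_inv_closed U.m_closed by (simp add: M.minus_eq a_inv_def)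
  moreover have "w' \<ominus>\<^bsub>M\<^esub> w \<in> W"
    using mem W.m_inv_closed W.m_closed by (simp add: M.minus_eq a_inv_def)
  ultimately have "u \<ominus>\<^bsub>M\<^esub> u' = \<zero>\<^bsub>M\<^esub>"
    using assms(3) by auto
  moreover have "u = (u \<ominus>\<^bsub>M\<^esub> u') \<oplus>\<^bsub>M\<^esub> u'"
    using closed by (simp add: M.minus_eq M.a_assoc M.l_neg)
  ultimately show ?thesis
    using closed by simp
qed

definition direct_sum_projection :: "'b set \<Rightarrow> 'b set \<Rightarrow> 'b \<Rightarrow> 'b" where
  "direct_sum_projection U W = (\<lambda>x\<in>carrier M. THE u. u \<in> U \<and> (\<exists>w\<in>W. x = u \<oplus>\<^bsub>M\<^esub> w))"

lemma direct_sum_projection_add: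
  assumes sub: "submodule U R M" "submodule W R M" and direct: "U \<inter> W = {\<zero>\<^bsub>M\<^esub>}"
    and mem: "u \<in> U" "w \<in> W"
  shows "direct_sum_projection U W (u \<oplus>\<^bsub>M\<^esub> w) = u"
proof -
  have "u \<oplus>\<^bsub>M\<^esub> w \<in> carrier M"
    using subgroup.subset[OF submodule.axioms(1)[OF sub(1)]]
      subgroup.subset[OF submodule.axioms(1)[OF sub(2)]] mem by auto
  moreover have "(THE u'. u' \<in> U \<and> (\<exists>w'\<in>W. u \<oplus>\<^bsub>M\<^esub> w = u' \<oplus>\<^bsub>M\<^esub> w')) = u"
    using mem direct_sum_component_unique[OF sub direct] by (intro the_equality) blast+
  ultimately show ?thesis
    by (simp add: direct_sum_projection_def)
qed

lemma direct_sum_projection_in_module_End: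
  assumes sub: "submodule U R M" "submodule W R M" and direct: "U \<inter> W = {\<zero>\<^bsub>M\<^esub>}"
    and sum: "U <+>\<^bsub>M\<^esub> W = carrier M"
  shows "direct_sum_projection U W \<in> module_End R M"
proof -
  interpret U: submodule U R M by (rule sub)
  interpret W: submodule W R M by (rule sub)
  let ?f = "direct_sum_projection U W"
  note project = direct_sum_projection_add[OF sub direct]
  have U_closed: "u \<in> carrier M" if "u \<in> U" for u
    using that U.subset by auto
  have W_closed: "w \<in> carrier M" if "w \<in> W" for w
    using that W.subset by auto
  have decompose: "\<exists>u\<in>U. \<exists>w\<in>W. x = u \<oplus>\<^bsub>M\<^esub> w" if "x \<in> carrier M" for x
    using that unfolding sum[symmetric] set_add_def' by blast
  show ?thesis
    unfolding module_End_def
  proof (intro CollectI conjI ballI)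
    show "?f \<in> carrier M \<rightarrow>\<^sub>E carrier M"
      using decompose project U_closed by (fastforce simp: direct_sum_projection_def)
  next
    fix x y assume "x \<in> carrier M" "y \<in> carrier M"
    then obtain u w u' w' where mem: "u \<in> U" "w \<in> W" "u' \<in> U" "w' \<in> W"
      and xy_eq: "x = u \<oplus>\<^bsub>M\<^esub> w" "y = u' \<oplus>\<^bsub>M\<^esub> w'"
      using decompose by metis
    have "x \<oplus>\<^bsub>M\<^esub> y = (u \<oplus>\<^bsub>M\<^esub> u') \<oplus>\<^bsub>M\<^esub> (w \<oplus>\<^bsub>M\<^esub> w')"
      using mem U_closed W_closed by (simp add: xy_eq M.add.m_ac)
    then show "?f (x \<oplus>\<^bsub>M\<^esub> y) = ?f x \<oplus>\<^bsub>M\<^esub> ?f y"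
      using mem U.m_closed W.m_closed by (simp add: xy_eq project)
  next
    fix a x assume a_carrier: "a \<in> carrier R" and "x \<in> carrier M"
    then obtain u w where mem: "u \<in> U" "w \<in> W" and x_eq: "x = u \<oplus>\<^bsub>M\<^esub> w"
      using decompose by blast
    then have "a \<odot>\<^bsub>M\<^esub> x = a \<odot>\<^bsub>M\<^esub> u \<oplus>\<^bsub>M\<^esub> a \<odot>\<^bsub>M\<^esub> w"
      using a_carrier U_closed W_closed smult_r_distr by blast
    then show "?f (a \<odot>\<^bsub>M\<^esub> x) = a \<odot>\<^bsub>M\<^esub> ?f x"
      using a_carrier mem U.smult_closed W.smult_closed by (simp add: x_eq project)
  qed
qed

lemma indecomposable_if_idempotents_trivial:
  assumes nonzero: "carrier M \<noteq> {\<zero>\<^bsub>M\<^esub>}"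
    and trivial: "\<And>f. \<lbrakk>f \<in> module_End R M; \<And>x. x \<in> carrier M \<Longrightarrow> f (f x) = f x\<rbrakk>
      \<Longrightarrow> (\<forall>x\<in>carrier M. f x = \<zero>\<^bsub>M\<^esub>) \<or> (\<forall>x\<in>carrier M. f x = x)"
  shows "indecomposable_module R M"
proof -
  have "U = {\<zero>\<^bsub>M\<^esub>} \<or> W = {\<zero>\<^bsub>M\<^esub>}"
    if sub: "submodule U R M" "submodule W R M" and direct: "U \<inter> W = {\<zero>\<^bsub>M\<^esub>}"
      and sum: "U <+>\<^bsub>M\<^esub> W = carrier M" for U W
  proof -
    have zero: "\<zero>\<^bsub>M\<^esub> \<in> U" "\<zero>\<^bsub>M\<^esub> \<in> W" and closed: "U \<subseteq> carrier M" "W \<subseteq> carrier M"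
      using sub direct submodule.axioms(1) subgroup.subset by fastforce+
    let ?f = "direct_sum_projection U W"
    note project = direct_sum_projection_add[OF sub direct]
    have on_U: "?f u = u" if "u \<in> U" for u
      using project[OF that zero(2)] that closed by auto
    have on_W: "?f w = \<zero>\<^bsub>M\<^esub>" if "w \<in> W" for w
      using project[OF zero(1) that] that closed by auto
    have "?f x \<in> U" if "x \<in> carrier M" for x
      using that project unfolding sum[symmetric] set_add_def' by auto
    then have "(\<forall>x\<in>carrier M. ?f x = \<zero>\<^bsub>M\<^esub>) \<or> (\<forall>x\<in>carrier M. ?f x = x)"
      using on_U direct_sum_projection_in_module_End[OF sub direct sum] by (intro trivial) auto
    then show ?thesis
    proof
      assume "\<forall>x\<in>carrier M. ?f x = \<zero>\<^bsub>M\<^esub>"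
      then have "\<forall>u\<in>U. u = \<zero>\<^bsub>M\<^esub>"
        using on_U closed(1) by (metis subsetD)
      then show ?thesis
        using zero(1) by blast
    next
      assume "\<forall>x\<in>carrier M. ?f x = x"
      then have "\<forall>w\<in>W. w = \<zero>\<^bsub>M\<^esub>"
        using on_W closed(2) by (metis subsetD)
      then show ?thesis
        using zero(2) by blast
    qed
  qed
  then show ?thesis
    using nonzero left_module_axioms by (simp add: indecomposable_module_def)
qed

end

subsection \<open>Entries and cells of a standard composition tableau\<close>

lemma
  assumes "T \<in> SCT \<alpha>"
  shows SCT_PiE: "T \<in> diagram \<alpha> \<rightarrow>\<^sub>E {1..sum_list \<alpha>}"
    and SCT_bij: "bij_betw T (diagram \<alpha>) {1..sum_list \<alpha>}"
    and SCT_row: "\<lbrakk>(i, j) \<in> diagram \<alpha>; (i, k) \<in> diagram \<alpha>; j < k\<rbrakk> \<Longrightarrow> T (i, k) < T (i, j)"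
    and SCT_first_column:
      "\<lbrakk>(i, 1) \<in> diagram \<alpha>; (j, 1) \<in> diagram \<alpha>; i < j\<rbrakk> \<Longrightarrow> T (i, 1) < T (j, 1)"
    and SCT_triple: "\<lbrakk>(j, k) \<in> diagram \<alpha>; (i, k - 1) \<in> diagram \<alpha>; i < j; T (j, k) < T (i, k - 1)\<rbrakk>
      \<Longrightarrow> (i, k) \<in> diagram \<alpha> \<and> T (j, k) < T (i, k)"
  using assms unfolding SCT_def mem_Collect_eq by blast+

lemma diagram_left: "\<lbrakk>(r, q) \<in> diagram \<alpha>; 1 \<le> p; p \<le> q\<rbrakk> \<Longrightarrow> (r, p) \<in> diagram \<alpha>"
  by (auto simp: diagram_def)

lemma diagram_column_pos: "(r, q) \<in> diagram \<alpha> \<Longrightarrow> 1 \<le> q"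
  by (auto simp: diagram_def)

lemma finite_diagram: "T \<in> SCT \<alpha> \<Longrightarrow> finite (diagram \<alpha>)"
  using bij_betw_finite[OF SCT_bij] by auto

lemma entry_in_range:
  "\<lbrakk>T \<in> SCT \<alpha>; x \<in> diagram \<alpha>\<rbrakk> \<Longrightarrow> T x \<in> {1..sum_list \<alpha>}"
  using SCT_PiE by blast

lemma cell_of_in_diagram:
  "\<lbrakk>T \<in> SCT \<alpha>; k \<in> {1..sum_list \<alpha>}\<rbrakk> \<Longrightarrow> cell_of \<alpha> T k \<in> diagram \<alpha>"
  unfolding cell_of_def using SCT_bij
  by (metis bij_betw_def order_refl the_inv_into_into)

lemma entry_cell_of [simp]:
  "\<lbrakk>T \<in> SCT \<alpha>; k \<in> {1..sum_list \<alpha>}\<rbrakk> \<Longrightarrow> T (cell_of \<alpha> T k) = k"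
  unfolding cell_of_def using SCT_bij by (metis bij_betw_def f_the_inv_into_f)

lemma cell_of_entry [simp]:
  "\<lbrakk>T \<in> SCT \<alpha>; x \<in> diagram \<alpha>\<rbrakk> \<Longrightarrow> cell_of \<alpha> T (T x) = x"
  unfolding cell_of_def using SCT_bij by (metis bij_betw_def the_inv_into_f_f)

lemma cell_of_eqD:
  assumes "T \<in> SCT \<alpha>" "k \<in> {1..sum_list \<alpha>}" "cell_of \<alpha> T k = (r, q)"
  shows "(r, q) \<in> diagram \<alpha>" "T (r, q) = k"
  using cell_of_in_diagram[OF assms(1,2)] entry_cell_of[OF assms(1,2)] assms(3) by auto

lemma cell_of_eq_iff:
  "\<lbrakk>T \<in> SCT \<alpha>; k \<in> {1..sum_list \<alpha>}; l \<in> {1..sum_list \<alpha>}\<rbrakk>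
     \<Longrightarrow> cell_of \<alpha> T k = cell_of \<alpha> T l \<longleftrightarrow> k = l"
  by (metis entry_cell_of)

lemma SCT_eqI:
  assumes "T \<in> SCT \<alpha>" "U \<in> SCT \<alpha>"
    and "\<And>k. k \<in> {1..sum_list \<alpha>} \<Longrightarrow> cell_of \<alpha> T k = cell_of \<alpha> U k"
  shows "T = U"
proof (rule PiE_ext[OF SCT_PiE[OF assms(1)] SCT_PiE[OF assms(2)]])
  fix x assume "x \<in> diagram \<alpha>"
  then show "T x = U x"
    using assms entry_in_range by (metis cell_of_entry entry_cell_of)
qed

lemma equiv_sct_equiv: "equiv (SCT \<alpha>) (sct_equiv \<alpha>)"
  by (rule equivI) (auto simp: sct_equiv_def refl_on_def sym_def trans_def)

lemma sct_equiv_SCT: "(T, U) \<in> sct_equiv \<alpha> \<Longrightarrow> T \<in> SCT \<alpha> \<and> U \<in> SCT \<alpha>"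
  by (simp add: sct_equiv_def)

lemma sct_equiv_refl: "T \<in> SCT \<alpha> \<Longrightarrow> (T, T) \<in> sct_equiv \<alpha>"
  by (simp add: sct_equiv_def)

lemma sct_equiv_sym: "(T, U) \<in> sct_equiv \<alpha> \<Longrightarrow> (U, T) \<in> sct_equiv \<alpha>"
  using equiv_sct_equiv by (metis equivE symE)

lemma sct_equiv_trans:
  "\<lbrakk>(T, U) \<in> sct_equiv \<alpha>; (U, V) \<in> sct_equiv \<alpha>\<rbrakk> \<Longrightarrow> (T, V) \<in> sct_equiv \<alpha>"
  using equiv_sct_equiv by (metis equivE transE)

lemma sct_equiv_less_iff:
  "\<lbrakk>(T, U) \<in> sct_equiv \<alpha>; (i, k) \<in> diagram \<alpha>; (j, k) \<in> diagram \<alpha>\<rbrakk>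
     \<Longrightarrow> T (i, k) < T (j, k) \<longleftrightarrow> U (i, k) < U (j, k)"
  by (auto simp: sct_equiv_def)

subsection \<open>The position of consecutive entries\<close>

text \<open>If \<open>i\<close> and \<open>i + 1\<close> occupy the cells \<open>x\<close> and \<open>y\<close> of \<open>T\<close>, then these are the cases in which
  \<open>\<pi>\<^sub>i T\<close> is \<open>T\<close>, \<open>0\<close> and \<open>s\<^sub>i T\<close>.\<close>

definition fixing :: "nat \<times> nat \<Rightarrow> nat \<times> nat \<Rightarrow> bool" where
  "fixing x y \<longleftrightarrow> snd y < snd x"

definition killing :: "nat \<times> nat \<Rightarrow> nat \<times> nat \<Rightarrow> bool" where
  "killing x y \<longleftrightarrow> snd x \<le> snd y \<and> attacks x y"

definition raising :: "nat \<times> nat \<Rightarrow> nat \<times> nat \<Rightarrow> bool" where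
  "raising x y \<longleftrightarrow> snd x < snd y \<and> \<not> attacks x y"

lemma attacks_same_column: "\<lbrakk>x \<noteq> y; snd x = snd y\<rbrakk> \<Longrightarrow> attacks x y"
  by (cases x; cases y) simp

lemma fixing_killing_raising:
  assumes "x \<noteq> y"
  obtains "fixing x y" | "killing x y" | "raising x y"
  using assms attacks_same_column[of x y]
  unfolding fixing_def killing_def raising_def by linarith

lemma raising_imp_fixing: "raising x y \<Longrightarrow> fixing y x"
  by (simp add: fixing_def raising_def)

lemma Des_iff:
  "i \<in> Des \<alpha> T \<longleftrightarrow> i \<in> {1..<sum_list \<alpha>} \<and> \<not> fixing (cell_of \<alpha> T i) (cell_of \<alpha> T (Suc i))"
  by (auto simp: Des_def col_of_def fixing_def)

lemma ADes_iff:
  "i \<in> ADes \<alpha> T \<longleftrightarrow> i \<in> {1..<sum_list \<alpha>} \<and> killing (cell_of \<alpha> T i) (cell_of \<alpha> T (Suc i))"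
  by (auto simp: ADes_def Des_def col_of_def killing_def)

lemma nADes_iff:
  assumes "T \<in> SCT \<alpha>"
  shows "i \<in> nADes \<alpha> T \<longleftrightarrow>
    i \<in> {1..<sum_list \<alpha>} \<and> raising (cell_of \<alpha> T i) (cell_of \<alpha> T (Suc i))"
proof -
  have "cell_of \<alpha> T i \<noteq> cell_of \<alpha> T (Suc i)" if "i \<in> {1..<sum_list \<alpha>}"
    using that by (simp add: cell_of_eq_iff[OF assms])
  then show ?thesis
    using attacks_same_column[of "cell_of \<alpha> T i" "cell_of \<alpha> T (Suc i)"]
    unfolding nADes_def Diff_iff Des_iff ADes_iff fixing_def killing_def raising_def by linarith
qed

subsection \<open>Interchanging consecutive entries\<close>

definition swappable :: "nat \<times> nat \<Rightarrow> nat \<times> nat \<Rightarrow> bool" where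
  "swappable x y \<longleftrightarrow> fst x \<noteq> fst y \<and> snd x \<noteq> snd y \<and> \<not> attacks x y \<and> \<not> attacks y x"

lemma raising_iff_swappable:
  "fst x \<noteq> fst y \<Longrightarrow> raising x y \<longleftrightarrow> swappable x y \<and> snd x < snd y"
  by (cases x; cases y) (auto simp: raising_def swappable_def)

text \<open>The conditions defining tableaux and their equivalence compare entries in unswappable cells
  only.\<close>

lemma SCT_same_order:
  assumes T_SCT: "T \<in> SCT \<alpha>" and ext: "U \<in> extensional (diagram \<alpha>)"
    and bij: "bij_betw U (diagram \<alpha>) {1..sum_list \<alpha>}"
    and order: "\<And>x y. \<lbrakk>x \<in> diagram \<alpha>; y \<in> diagram \<alpha>; \<not> swappable x y\<rbrakk> \<Longrightarrow> U x < U y \<longleftrightarrow> T x < T y"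
  shows "(T, U) \<in> sct_equiv \<alpha>"
proof -
  have column: "U (r, k) < U (s, k) \<longleftrightarrow> T (r, k) < T (s, k)"
    if "(r, k) \<in> diagram \<alpha>" "(s, k) \<in> diagram \<alpha>" for r s k
    using order[of "(r, k)" "(s, k)"] that by (simp add: swappable_def)
  have row: "U (r, k) < U (r, j)"
    if "(r, j) \<in> diagram \<alpha>" "(r, k) \<in> diagram \<alpha>" "j < k" for r j k
    using SCT_row[OF T_SCT that] order[of "(r, k)" "(r, j)"] that by (simp add: swappable_def)
  have triple: "(r, k) \<in> diagram \<alpha> \<and> U (s, k) < U (r, k)"
    if cells: "(s, k) \<in> diagram \<alpha>" "(r, k - 1) \<in> diagram \<alpha>" and "r < s"
      and less: "U (s, k) < U (r, k - 1)" for r s k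
  proof -
    have "attacks (r, k - 1) (s, k)"
      using diagram_column_pos[OF cells(2)] \<open>r < s\<close> by simp
    then have "T (s, k) < T (r, k - 1)"
      using order[OF cells] less by (simp add: swappable_def)
    then show ?thesis
      using SCT_triple[OF T_SCT cells \<open>r < s\<close>] column cells(1) by blast
  qed
  have "U \<in> diagram \<alpha> \<rightarrow>\<^sub>E {1..sum_list \<alpha>}"
    using bij_betwE[OF bij] ext by (auto simp: PiE_def)
  then have "U \<in> SCT \<alpha>"
    unfolding SCT_def mem_Collect_eq
    using bij row column SCT_first_column[OF T_SCT] triple by (intro conjI allI impI) blast+
  then show ?thesis
    using T_SCT column by (simp add: sct_equiv_def)
qed

lemma transpose_less_iff:
  "{a, b} \<noteq> {i, Suc i} \<Longrightarrow> transpose i (Suc i) a < transpose i (Suc i) b \<longleftrightarrow> a < b"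
  by (auto simp: transpose_def)

lemma swap_entries_less_iff:
  assumes "T \<in> SCT \<alpha>" "x \<in> diagram \<alpha>" "y \<in> diagram \<alpha>"
    and "{x, y} \<noteq> {cell_of \<alpha> T i, cell_of \<alpha> T (Suc i)}"
  shows "swap_entries \<alpha> i T x < swap_entries \<alpha> i T y \<longleftrightarrow> T x < T y"
proof -
  have "cell_of \<alpha> T ` {T x, T y} \<noteq> cell_of \<alpha> T ` {i, Suc i}"
    using assms by simp
  then have "{T x, T y} \<noteq> {i, Suc i}"
    by metis
  then show ?thesis
    using transpose_less_iff assms(2,3) by (simp add: swap_entries_def)
qed

lemma bij_betw_swap_entries:
  assumes "T \<in> SCT \<alpha>" "i \<in> {1..<sum_list \<alpha>}"
  shows "bij_betw (swap_entries \<alpha> i T) (diagram \<alpha>) {1..sum_list \<alpha>}"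
proof -
  have "bij_betw (transpose i (Suc i)) {1..sum_list \<alpha>} {1..sum_list \<alpha>}"
    using assms(2) by (intro bij_betwI[where g = "transpose i (Suc i)"]) (auto simp: transpose_def)
  then have "bij_betw (transpose i (Suc i) \<circ> T) (diagram \<alpha>) {1..sum_list \<alpha>}"
    by (rule bij_betw_trans[OF SCT_bij[OF assms(1)]])
  then show ?thesis
    by (rule bij_betw_cong[THEN iffD1, rotated]) (simp add: swap_entries_def)
qed

lemma swap_entries_equiv:
  assumes "T \<in> SCT \<alpha>" "i \<in> {1..<sum_list \<alpha>}"
    and "swappable (cell_of \<alpha> T i) (cell_of \<alpha> T (Suc i))"
  shows "(T, swap_entries \<alpha> i T) \<in> sct_equiv \<alpha>"
proof (rule SCT_same_order[OF assms(1) _ bij_betw_swap_entries[OF assms(1,2)]])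
  show "swap_entries \<alpha> i T \<in> extensional (diagram \<alpha>)"
    by (simp add: swap_entries_def)
  fix x y assume "x \<in> diagram \<alpha>" "y \<in> diagram \<alpha>" "\<not> swappable x y"
  then show "swap_entries \<alpha> i T x < swap_entries \<alpha> i T y \<longleftrightarrow> T x < T y"
    using assms by (intro swap_entries_less_iff) (auto simp: doubleton_eq_iff swappable_def)
qed

lemma swap_entries_swap_entries:
  "T \<in> SCT \<alpha> \<Longrightarrow> swap_entries \<alpha> i (swap_entries \<alpha> i T) = T"
  using SCT_PiE[of T \<alpha>] by (auto simp: swap_entries_def fun_eq_iff PiE_def extensional_def)

lemma cell_of_swap_entries:
  assumes "T \<in> SCT \<alpha>" "swap_entries \<alpha> i T \<in> SCT \<alpha>"
    and "i \<in> {1..<sum_list \<alpha>}" "k \<in> {1..sum_list \<alpha>}"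
  shows "cell_of \<alpha> (swap_entries \<alpha> i T) k = cell_of \<alpha> T (transpose i (Suc i) k)"
proof -
  let ?x = "cell_of \<alpha> T (transpose i (Suc i) k)"
  have range: "transpose i (Suc i) k \<in> {1..sum_list \<alpha>}"
    using assms(3,4) by (auto simp: transpose_def)
  then have "?x \<in> diagram \<alpha>"
    by (rule cell_of_in_diagram[OF assms(1)])
  moreover from this have "swap_entries \<alpha> i T ?x = k"
    using assms(1) range by (simp add: swap_entries_def)
  ultimately show ?thesis
    using cell_of_entry[OF assms(2)] by metis
qed

lemma raising_swappable:
  assumes T_SCT: "T \<in> SCT \<alpha>" and i_range: "i \<in> {1..<sum_list \<alpha>}"
    and raising: "raising (cell_of \<alpha> T i) (cell_of \<alpha> T (Suc i))"
  shows "swappable (cell_of \<alpha> T i) (cell_of \<alpha> T (Suc i))"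
proof -
  obtain r q s p where cells: "cell_of \<alpha> T i = (r, q)" "cell_of \<alpha> T (Suc i) = (s, p)"
    by fastforce
  have "(r, q) \<in> diagram \<alpha>" "(s, p) \<in> diagram \<alpha>" "T (r, q) < T (s, p)"
    using cell_of_eqD[OF T_SCT _ cells(1)] cell_of_eqD[OF T_SCT _ cells(2)] i_range by auto
  then have "r \<noteq> s"
    using SCT_row[OF T_SCT, of r q p] raising cells by (auto simp: raising_def)
  then show ?thesis
    using raising cells raising_iff_swappable[of "(r, q)" "(s, p)"] by simp
qed

lemma
  assumes "T \<in> SCT \<alpha>" "i \<in> {1..<sum_list \<alpha>}" "raising (cell_of \<alpha> T i) (cell_of \<alpha> T (Suc i))"
  shows swap_raising_equiv: "(T, swap_entries \<alpha> i T) \<in> sct_equiv \<alpha>"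
    and swap_raising_SCT: "swap_entries \<alpha> i T \<in> SCT \<alpha>"
    and cell_of_swap_raising: "k \<in> {1..sum_list \<alpha>}
      \<Longrightarrow> cell_of \<alpha> (swap_entries \<alpha> i T) k = cell_of \<alpha> T (transpose i (Suc i) k)"
  using swap_entries_equiv raising_swappable sct_equiv_SCT cell_of_swap_entries assms by metis+

lemma consecutive_in_row_adjacent:
  assumes T_SCT: "T \<in> SCT \<alpha>" and diagram: "(r, q) \<in> diagram \<alpha>" "(r, p) \<in> diagram \<alpha>"
    and "p < q" and entries: "T (r, p) = Suc (T (r, q))"
  shows "q = Suc p"
proof (rule ccontr)
  assume "q \<noteq> Suc p"
  then have "Suc p < q"
    using \<open>p < q\<close> by simp
  moreover from this have middle: "(r, Suc p) \<in> diagram \<alpha>"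
    using diagram_left[OF diagram(1)] by simp
  ultimately have "T (r, q) < T (r, Suc p)" "T (r, Suc p) < T (r, p)"
    using SCT_row[OF T_SCT middle diagram(1)] SCT_row[OF T_SCT diagram(2) middle] by auto
  then show False
    using entries by simp
qed

lemma successor_not_attacks:
  assumes T_SCT: "T \<in> SCT \<alpha>" and diagram: "(r, q) \<in> diagram \<alpha>" "(s, p) \<in> diagram \<alpha>"
    and "p < q" and entries: "T (s, p) = Suc (T (r, q))"
  shows "\<not> attacks (s, p) (r, q)"
proof
  assume "attacks (s, p) (r, q)"
  then have "q = Suc p" "s < r"
    using \<open>p < q\<close> by auto
  then have "(s, q) \<in> diagram \<alpha>" "T (r, q) < T (s, q)"
    using SCT_triple[OF T_SCT, of r q s] diagram entries by auto
  then show False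
    using SCT_row[OF T_SCT diagram(2), of q] \<open>p < q\<close> entries by simp
qed

lemma nondescent_cases:
  assumes T_SCT: "T \<in> SCT \<alpha>" and i_nondescent: "i \<in> {1..<sum_list \<alpha>}" "i \<notin> Des \<alpha> T"
  obtains r q where "cell_of \<alpha> T i = (r, Suc q)" "cell_of \<alpha> T (Suc i) = (r, q)"
  | "swappable (cell_of \<alpha> T i) (cell_of \<alpha> T (Suc i))"
proof -
  obtain r q s p where cells: "cell_of \<alpha> T i = (r, q)" "cell_of \<alpha> T (Suc i) = (s, p)"
    by fastforce
  have columns: "p < q"
    using i_nondescent cells by (simp add: Des_iff fixing_def)
  have diagram: "(r, q) \<in> diagram \<alpha>" "(s, p) \<in> diagram \<alpha>" and entries: "T (s, p) = Suc (T (r, q))"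
    using cell_of_eqD[OF T_SCT _ cells(1)] cell_of_eqD[OF T_SCT _ cells(2)] i_nondescent by auto
  show thesis
  proof (cases "r = s")
    case True
    then have "q = Suc p"
      using consecutive_in_row_adjacent[OF T_SCT] diagram columns entries by blast
    then show thesis
      using True cells that(1) by simp
  next
    case False
    then show thesis
      using successor_not_attacks[OF T_SCT diagram columns entries] cells columns that(2)
      by (simp add: swappable_def)
  qed
qed

lemma swap_nondescent_nADes:
  assumes T_SCT: "T \<in> SCT \<alpha>" and i_nondescent: "i \<in> {1..<sum_list \<alpha>}" "i \<notin> Des \<alpha> T"
    and swappable: "swappable (cell_of \<alpha> T i) (cell_of \<alpha> T (Suc i))"
  shows "i \<in> nADes \<alpha> (swap_entries \<alpha> i T)"
proof -
  have swap_SCT: "swap_entries \<alpha> i T \<in> SCT \<alpha>"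
    using swap_entries_equiv[OF T_SCT i_nondescent(1) swappable] sct_equiv_SCT by blast
  have "raising (cell_of \<alpha> T (Suc i)) (cell_of \<alpha> T i)"
    using i_nondescent swappable by (simp add: Des_iff fixing_def raising_def swappable_def)
  then show ?thesis
    using i_nondescent(1) cell_of_swap_entries[OF T_SCT swap_SCT i_nondescent(1)]
    by (simp add: nADes_iff[OF swap_SCT])
qed

subsection \<open>Inversions and raising paths\<close>

definition invs :: "nat list \<Rightarrow> tableau \<Rightarrow> ((nat \<times> nat) \<times> (nat \<times> nat)) set" where
  "invs \<alpha> T = {(x, y). x \<in> diagram \<alpha> \<and> y \<in> diagram \<alpha> \<and> snd x < snd y \<and> T y < T x}"

lemma finite_invs: "T \<in> SCT \<alpha> \<Longrightarrow> finite (invs \<alpha> T)"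
  by (rule finite_subset[of _ "diagram \<alpha> \<times> diagram \<alpha>"]) (auto simp: invs_def finite_diagram)

lemma invs_swap_raising:
  assumes T_SCT: "T \<in> SCT \<alpha>" and i_range: "i \<in> {1..<sum_list \<alpha>}"
    and raising: "raising (cell_of \<alpha> T i) (cell_of \<alpha> T (Suc i))"
  shows "invs \<alpha> (swap_entries \<alpha> i T) = insert (cell_of \<alpha> T i, cell_of \<alpha> T (Suc i)) (invs \<alpha> T)"
proof -
  let ?U = "swap_entries \<alpha> i T" and ?x = "cell_of \<alpha> T i" and ?y = "cell_of \<alpha> T (Suc i)"
  have cells: "?x \<in> diagram \<alpha>" "?y \<in> diagram \<alpha>" and columns: "snd ?x < snd ?y"
    using cell_of_in_diagram[OF T_SCT] i_range raising by (auto simp: raising_def)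
  have swapped: "?U ?x = Suc i" "?U ?y = i"
    using T_SCT i_range cells by (auto simp: swap_entries_def)
  have "(a, b) \<in> invs \<alpha> ?U \<longleftrightarrow> (a, b) = (?x, ?y) \<or> (a, b) \<in> invs \<alpha> T" for a b
  proof (cases "a \<in> diagram \<alpha> \<and> b \<in> diagram \<alpha> \<and> snd a < snd b \<and> (a, b) \<noteq> (?x, ?y)")
    case True
    then have "{b, a} \<noteq> {?x, ?y}"
      using columns by (auto simp: doubleton_eq_iff)
    then show ?thesis
      using True swap_entries_less_iff[OF T_SCT, of b a] by (auto simp: invs_def)
  next
    case False
    then show ?thesis
      using cells columns swapped by (auto simp: invs_def)
  qed
  then show ?thesis
    by auto
qed

lemma card_invs_swap:
  assumes T_SCT: "T \<in> SCT \<alpha>" and i_nADes: "i \<in> nADes \<alpha> T"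
  shows "card (invs \<alpha> (swap_entries \<alpha> i T)) = Suc (card (invs \<alpha> T))"
proof -
  have range: "i \<in> {1..<sum_list \<alpha>}"
    and raising: "raising (cell_of \<alpha> T i) (cell_of \<alpha> T (Suc i))"
    using i_nADes by (auto simp: nADes_iff[OF T_SCT])
  then have "(cell_of \<alpha> T i, cell_of \<alpha> T (Suc i)) \<notin> invs \<alpha> T"
    using T_SCT by (simp add: invs_def)
  then show ?thesis
    using invs_swap_raising[OF T_SCT range raising] finite_invs[OF T_SCT] by simp
qed

text \<open>The word is read from right to left, as the product of operators which it represents.\<close>

inductive raising_path :: "nat list \<Rightarrow> tableau \<Rightarrow> nat list \<Rightarrow> tableau \<Rightarrow> bool" for \<alpha> T where
  Nil: "T \<in> SCT \<alpha> \<Longrightarrow> raising_path \<alpha> T [] T"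
| Cons: "\<lbrakk>raising_path \<alpha> T ws U; i \<in> nADes \<alpha> U\<rbrakk> \<Longrightarrow> raising_path \<alpha> T (i # ws) (swap_entries \<alpha> i U)"

lemma raising_path_equiv: "raising_path \<alpha> T ws U \<Longrightarrow> (T, U) \<in> sct_equiv \<alpha>"
proof (induction rule: raising_path.induct)
  case Nil
  then show ?case
    by (rule sct_equiv_refl)
next
  case (Cons ws U i)
  then show ?case
    using swap_raising_equiv sct_equiv_trans sct_equiv_SCT nADes_iff by blast
qed

lemma raising_path_SCT: "raising_path \<alpha> T ws U \<Longrightarrow> U \<in> SCT \<alpha>"
  using raising_path_equiv sct_equiv_SCT by blast

lemma raising_path_letters: "raising_path \<alpha> T ws U \<Longrightarrow> set ws \<subseteq> {1..<sum_list \<alpha>}"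
proof (induction rule: raising_path.induct)
  case (Cons ws U i)
  then show ?case
    by (auto simp: nADes_def Des_def)
qed simp

lemma raising_path_upt:
  assumes T_SCT: "T \<in> SCT \<alpha>" and "1 \<le> k" "k \<le> j" "j \<le> sum_list \<alpha>"
    and "\<And>l. l \<in> {k<..j} \<Longrightarrow> raising (cell_of \<alpha> T k) (cell_of \<alpha> T l)"
  obtains U where "raising_path \<alpha> T (rev [k..<j]) U" "cell_of \<alpha> U j = cell_of \<alpha> T k"
    "\<And>l. l \<in> {j<..sum_list \<alpha>} \<Longrightarrow> cell_of \<alpha> U l = cell_of \<alpha> T l"
proof -
  have "\<exists>U. raising_path \<alpha> T (rev [k..<j]) U \<and> cell_of \<alpha> U j = cell_of \<alpha> T k \<and>
    (\<forall>l\<in>{j<..sum_list \<alpha>}. cell_of \<alpha> U l = cell_of \<alpha> T l)"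
    using assms(3-5)
  proof (induction j rule: dec_induct)
    case base
    then show ?case
      using raising_path.Nil[OF T_SCT] by auto
  next
    case (step j)
    then obtain U where path: "raising_path \<alpha> T (rev [k..<j]) U"
      and lower: "cell_of \<alpha> U j = cell_of \<alpha> T k"
      and upper: "\<forall>l\<in>{j<..sum_list \<alpha>}. cell_of \<alpha> U l = cell_of \<alpha> T l"
      by fastforce
    have U_SCT: "U \<in> SCT \<alpha>"
      by (rule raising_path_SCT[OF path])
    have range: "j \<in> {1..<sum_list \<alpha>}"
      using step \<open>1 \<le> k\<close> by simp
    have raising: "raising (cell_of \<alpha> U j) (cell_of \<alpha> U (Suc j))"
      using step.prems(2)[of "Suc j"] step.hyps lower upper range by simp
    have "raising_path \<alpha> T (rev [k..<Suc j]) (swap_entries \<alpha> j U)"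
      using raising_path.Cons[OF path, of j] step.hyps range raising
      by (simp add: nADes_iff[OF U_SCT])
    moreover have "cell_of \<alpha> (swap_entries \<alpha> j U) (Suc j) = cell_of \<alpha> T k"
      using cell_of_swap_raising[OF U_SCT range raising, of "Suc j"] lower range by simp
    moreover have "cell_of \<alpha> (swap_entries \<alpha> j U) l = cell_of \<alpha> T l"
      if "l \<in> {Suc j<..sum_list \<alpha>}" for l
      using cell_of_swap_raising[OF U_SCT range raising, of l] upper that
      by (simp add: transpose_apply_other)
    ultimately show ?case
      by blast
  qed
  then show thesis
    using that by blast
qed

subsection \<open>Source tableaux\<close>

definition source :: "nat list \<Rightarrow> tableau \<Rightarrow> bool" where
  "source \<alpha> S \<longleftrightarrow> S \<in> SCT \<alpha> \<and> (\<forall>i\<in>{1..<sum_list \<alpha>}. i \<notin> Des \<alpha> S \<longrightarrow>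
     (\<exists>r q. cell_of \<alpha> S i = (r, Suc q) \<and> cell_of \<alpha> S (Suc i) = (r, q)))"

lemma source_SCT: "source \<alpha> S \<Longrightarrow> S \<in> SCT \<alpha>"
  by (simp add: source_def)

lemma raising_path_from_source:
  assumes "T \<in> SCT \<alpha>"
  obtains S ws where "source \<alpha> S" "raising_path \<alpha> S ws T"
proof -
  have "\<exists>S ws. source \<alpha> S \<and> raising_path \<alpha> S ws T"
    using assms
  proof (induction "card (invs \<alpha> T)" arbitrary: T rule: less_induct)
    case less
    note T_SCT = \<open>T \<in> SCT \<alpha>\<close>
    show ?case
    proof (cases "source \<alpha> T")
      case True
      then show ?thesis
        using raising_path.Nil[OF T_SCT] by blast
    next
      case False
      then obtain i where i_nondescent: "i \<in> {1..<sum_list \<alpha>}" "i \<notin> Des \<alpha> T"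
        and swappable: "swappable (cell_of \<alpha> T i) (cell_of \<alpha> T (Suc i))"
        using T_SCT nondescent_cases[OF T_SCT] unfolding source_def by metis
      let ?U = "swap_entries \<alpha> i T"
      have U_SCT: "?U \<in> SCT \<alpha>"
        using swap_entries_equiv[OF T_SCT i_nondescent(1) swappable] sct_equiv_SCT by blast
      have nADes: "i \<in> nADes \<alpha> ?U"
        by (rule swap_nondescent_nADes[OF T_SCT i_nondescent swappable])
      have undo: "swap_entries \<alpha> i ?U = T"
        by (rule swap_entries_swap_entries[OF T_SCT])
      have "card (invs \<alpha> ?U) < card (invs \<alpha> T)"
        using card_invs_swap[OF U_SCT nADes] undo by simp
      then obtain S ws where "source \<alpha> S" "raising_path \<alpha> S ws ?U"
        using less.hyps U_SCT by blast
      then show ?thesis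
        using raising_path.Cons[OF _ nADes] undo by metis
    qed
  qed
  then show thesis
    using that by blast
qed

lemma source_column_drop:
  assumes S_source: "source \<alpha> S" and range: "1 \<le> k" "k < l" "l \<le> sum_list \<alpha>"
    and columns: "p < snd (cell_of \<alpha> S k)" "snd (cell_of \<alpha> S l) \<le> p"
  obtains g s where "g \<in> {k..<l}" "cell_of \<alpha> S g = (s, Suc p)" "cell_of \<alpha> S (Suc g) = (s, p)"
    "\<And>h. h \<in> {k..g} \<Longrightarrow> p < snd (cell_of \<alpha> S h)"
proof -
  obtain d where first_drop: "d < l - k" "\<forall>e\<le>d. \<not> snd (cell_of \<alpha> S (k + e)) \<le> p"
    "snd (cell_of \<alpha> S (k + Suc d)) \<le> p"
    using ex_least_nat_less[of "\<lambda>e. snd (cell_of \<alpha> S (k + e)) \<le> p" "l - k"] range columns by auto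
  define g where "g = k + d"
  have g_range: "g \<in> {k..<l}"
    using first_drop(1) by (auto simp: g_def)
  have right: "p < snd (cell_of \<alpha> S h)" if "h \<in> {k..g}" for h
  proof -
    have "h - k \<le> d" "k + (h - k) = h"
      using that by (auto simp: g_def)
    then show ?thesis
      using first_drop(2) by (metis not_le)
  qed
  have drop: "snd (cell_of \<alpha> S (Suc g)) \<le> p"
    using first_drop(3) by (simp add: g_def)
  have "g \<in> {1..<sum_list \<alpha>}"
    using g_range range by simp
  moreover from this have "g \<notin> Des \<alpha> S"
    using right[of g] drop g_range by (simp add: Des_iff fixing_def)
  ultimately obtain s q where "cell_of \<alpha> S g = (s, Suc q)" "cell_of \<alpha> S (Suc g) = (s, q)"
    using S_source by (auto simp: source_def)
  moreover from this have "q = p"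
    using right[of g] drop g_range by simp
  ultimately show thesis
    using that g_range right by blast
qed

definition last_difference :: "nat list \<Rightarrow> tableau \<Rightarrow> tableau \<Rightarrow> nat \<Rightarrow> bool" where
  "last_difference \<alpha> T U k \<longleftrightarrow> k \<in> {1..sum_list \<alpha>} \<and> cell_of \<alpha> T k \<noteq> cell_of \<alpha> U k \<and>
     (\<forall>l\<in>{k<..sum_list \<alpha>}. cell_of \<alpha> T l = cell_of \<alpha> U l)"

lemma last_difference_sym: "last_difference \<alpha> T U k \<Longrightarrow> last_difference \<alpha> U T k"
  by (auto simp: last_difference_def)

lemma last_difference_range: "last_difference \<alpha> T U k \<Longrightarrow> k \<in> {1..sum_list \<alpha>}"
  by (simp add: last_difference_def)

lemma last_difference_exists:
  assumes "T \<in> SCT \<alpha>" "U \<in> SCT \<alpha>" "T \<noteq> U"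
  obtains k where "last_difference \<alpha> T U k"
proof -
  let ?D = "{k \<in> {1..sum_list \<alpha>}. cell_of \<alpha> T k \<noteq> cell_of \<alpha> U k}"
  have "?D \<noteq> {}"
    using SCT_eqI[OF assms(1,2)] assms(3) by blast
  then have max: "Max ?D \<in> ?D"
    by (intro Max_in) auto
  have "cell_of \<alpha> T l = cell_of \<alpha> U l" if "l \<in> {Max ?D<..sum_list \<alpha>}" for l
  proof (rule ccontr)
    assume "\<not> ?thesis"
    then have "l \<le> Max ?D"
      using that by (intro Max_ge) auto
    then show False
      using that by simp
  qed
  then have "last_difference \<alpha> T U (Max ?D)"
    using max unfolding last_difference_def by blast
  then show thesis
    by (rule that)
qed

lemma last_difference_entry_above:
  assumes "T \<in> SCT \<alpha>" "U \<in> SCT \<alpha>" "last_difference \<alpha> T U k" "x \<in> diagram \<alpha>" "k < T x"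
  shows "U x = T x"
proof -
  have "T x \<in> {k<..sum_list \<alpha>}"
    using entry_in_range[OF assms(1,4)] assms(5) by simp
  then have "cell_of \<alpha> U (T x) = x"
    using assms(1,3,4) cell_of_entry unfolding last_difference_def by metis
  then show ?thesis
    using entry_cell_of[OF assms(2) entry_in_range[OF assms(1,4)]] by simp
qed

lemma last_difference_entry_below:
  assumes T_SCT: "T \<in> SCT \<alpha>" and U_SCT: "U \<in> SCT \<alpha>" and last: "last_difference \<alpha> T U k"
  shows "U (cell_of \<alpha> T k) < k"
proof -
  let ?x = "cell_of \<alpha> T k"
  have x_cell: "?x \<in> diagram \<alpha>" "T ?x = k" and differ: "?x \<noteq> cell_of \<alpha> U k"
    using last cell_of_in_diagram[OF T_SCT] T_SCT by (auto simp: last_difference_def)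
  have "U ?x \<noteq> k"
    using differ cell_of_entry[OF U_SCT x_cell(1)] by metis
  moreover have "\<not> k < U ?x"
    using last_difference_entry_above[OF U_SCT T_SCT last_difference_sym[OF last] x_cell(1)]
      x_cell(2) by auto
  ultimately show ?thesis
    by simp
qed

lemma last_difference_column_neq:
  assumes equiv: "(T, U) \<in> sct_equiv \<alpha>" and last: "last_difference \<alpha> T U k"
  shows "snd (cell_of \<alpha> T k) \<noteq> snd (cell_of \<alpha> U k)"
proof
  have T_SCT: "T \<in> SCT \<alpha>" and U_SCT: "U \<in> SCT \<alpha>" and k_range: "k \<in> {1..sum_list \<alpha>}"
    using sct_equiv_SCT[OF equiv] last_difference_range[OF last] by auto
  assume "snd (cell_of \<alpha> T k) = snd (cell_of \<alpha> U k)"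
  then obtain r s q where cells: "cell_of \<alpha> T k = (r, q)" "cell_of \<alpha> U k = (s, q)"
    by (metis prod.collapse)
  note T_cell = cell_of_eqD[OF T_SCT k_range cells(1)]
    and U_cell = cell_of_eqD[OF U_SCT k_range cells(2)]
  have "U (r, q) < k" "T (s, q) < k"
    using last_difference_entry_below[OF T_SCT U_SCT last]
      last_difference_entry_below[OF U_SCT T_SCT last_difference_sym[OF last]] cells by auto
  then show False
    using sct_equiv_less_iff[OF equiv U_cell(1) T_cell(1)] T_cell(2) U_cell(2) by simp
qed

lemma source_drop_entries:
  assumes S_source: "source \<alpha> S" and x_cell: "(r, Suc p) \<in> diagram \<alpha>"
    and k_bounds: "S (r, Suc p) < k" "k \<le> sum_list \<alpha>" and left: "snd (cell_of \<alpha> S k) \<le> p"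
  obtains s where "(s, Suc p) \<in> diagram \<alpha>" "(s, p) \<in> diagram \<alpha>"
    "S (r, Suc p) \<le> S (s, Suc p)" "S (s, p) = Suc (S (s, Suc p))" "S (s, p) \<le> k"
proof -
  have S_SCT: "S \<in> SCT \<alpha>"
    using S_source by (rule source_SCT)
  let ?e = "S (r, Suc p)"
  have "1 \<le> ?e" "p < snd (cell_of \<alpha> S ?e)"
    using entry_in_range[OF S_SCT x_cell] S_SCT x_cell by auto
  then obtain g s where g_drop: "g \<in> {?e..<k}"
    "cell_of \<alpha> S g = (s, Suc p)" "cell_of \<alpha> S (Suc g) = (s, p)"
    using source_column_drop[OF S_source _ k_bounds _ left] by metis
  then show thesis
    using that[of s] cell_of_eqD[OF S_SCT _ g_drop(2)] cell_of_eqD[OF S_SCT _ g_drop(3)]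
      \<open>1 \<le> ?e\<close> k_bounds by auto
qed

lemma source_last_difference_column:
  assumes S_source: "source \<alpha> S" and equiv: "(S, T) \<in> sct_equiv \<alpha>"
    and last: "last_difference \<alpha> S T k"
  shows "snd (cell_of \<alpha> T k) < snd (cell_of \<alpha> S k)"
proof (rule ccontr)
  assume not_left: "\<not> ?thesis"
  have S_SCT: "S \<in> SCT \<alpha>" and T_SCT: "T \<in> SCT \<alpha>" and k_range: "k \<in> {1..sum_list \<alpha>}"
    using sct_equiv_SCT[OF equiv] last_difference_range[OF last] by auto
  note last_sym = last_difference_sym[OF last]
  obtain r q where T_k: "cell_of \<alpha> T k = (r, q)"
    by fastforce
  have "snd (cell_of \<alpha> S k) < q"
    using not_left last_difference_column_neq[OF equiv last] T_k by simp
  then obtain p where q_Suc: "q = Suc p" and left: "snd (cell_of \<alpha> S k) \<le> p"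
    by (cases q) auto
  note T_cell = cell_of_eqD[OF T_SCT k_range T_k[unfolded q_Suc]]
  have "S (r, Suc p) < k"
    using last_difference_entry_below[OF T_SCT S_SCT last_sym] T_k q_Suc by simp
  then obtain s where cells: "(s, Suc p) \<in> diagram \<alpha>" "(s, p) \<in> diagram \<alpha>"
    and entries: "S (r, Suc p) \<le> S (s, Suc p)" "S (s, p) = Suc (S (s, Suc p))" "S (s, p) \<le> k"
    using source_drop_entries[OF S_source T_cell(1)] k_range left by (metis atLeastAtMost_iff)
  have below: "\<not> k < T (s, Suc p)" "\<not> k < T (s, p)"
    using last_difference_entry_above[OF T_SCT S_SCT last_sym] cells entries by force+
  show False
  proof (cases "s = r")
    case True
    then show False
      using SCT_row[OF T_SCT cells(2,1)] below(2) T_cell(2) by simp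
  next
    case False
    then have "S (r, Suc p) \<noteq> S (s, Suc p)"
      using cells(1) T_cell(1) cell_of_entry[OF S_SCT] by (metis Pair_inject)
    then show False
      using sct_equiv_less_iff[OF equiv T_cell(1) cells(1)] entries(1) below(1) T_cell(2) by simp
  qed
qed

lemma source_unique:
  assumes "source \<alpha> S" "source \<alpha> S'" "(S, S') \<in> sct_equiv \<alpha>"
  shows "S = S'"
proof (rule ccontr)
  assume "S \<noteq> S'"
  then obtain k where "last_difference \<alpha> S S' k"
    using last_difference_exists assms source_SCT by blast
  then show False
    using source_last_difference_column[OF assms(1,3)]
      source_last_difference_column[OF assms(2) sct_equiv_sym[OF assms(3)]] last_difference_sym
    by fastforce
qed

subsection \<open>Separating a tableau from its source\<close>

lemma last_difference_left_neighbour: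
  assumes S_SCT: "S \<in> SCT \<alpha>" and T_SCT: "T \<in> SCT \<alpha>" and last: "last_difference \<alpha> S T k"
    and S_k: "cell_of \<alpha> S k = (r, q)" and left: "snd (cell_of \<alpha> T k) < q"
  shows "(r, q - 1) \<in> diagram \<alpha>" "S (r, q - 1) \<in> {k<..sum_list \<alpha>}"
proof -
  note S_cell = cell_of_eqD[OF S_SCT last_difference_range[OF last] S_k]
  have "1 \<le> snd (cell_of \<alpha> T k)"
    using cell_of_in_diagram[OF T_SCT last_difference_range[OF last]] diagram_column_pos
    by (metis prod.collapse)
  then show left_cell: "(r, q - 1) \<in> diagram \<alpha>"
    using diagram_left[OF S_cell(1)] left by simp
  then show "S (r, q - 1) \<in> {k<..sum_list \<alpha>}"
    using SCT_row[OF S_SCT left_cell S_cell(1)] entry_in_range[OF S_SCT left_cell] S_cell(2) left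
    by simp
qed

lemma last_difference_not_above:
  assumes equiv: "(S, T) \<in> sct_equiv \<alpha>" and last: "last_difference \<alpha> S T k"
    and S_k: "cell_of \<alpha> S k = (r, q)" and T_k: "cell_of \<alpha> T k = (r', q - 1)"
  shows "r \<le> r'"
proof (rule ccontr)
  have S_SCT: "S \<in> SCT \<alpha>" and T_SCT: "T \<in> SCT \<alpha>" and k_range: "k \<in> {1..sum_list \<alpha>}"
    using sct_equiv_SCT[OF equiv] last_difference_range[OF last] by auto
  note S_cell = cell_of_eqD[OF S_SCT k_range S_k] and T_cell = cell_of_eqD[OF T_SCT k_range T_k]
  assume "\<not> r \<le> r'"
  moreover have "T (r, q) < T (r', q - 1)"
    using last_difference_entry_below[OF S_SCT T_SCT last] S_k T_cell(2) by simp
  ultimately have cell: "(r', q) \<in> diagram \<alpha>" and "T (r, q) < T (r', q)"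
    using SCT_triple[OF T_SCT S_cell(1) T_cell(1)] by auto
  then have "k < S (r', q)"
    using sct_equiv_less_iff[OF equiv S_cell(1)] S_cell(2) by simp
  also have "\<dots> < S (r', q - 1)"
    using SCT_row[OF S_SCT T_cell(1) cell] diagram_column_pos[OF cell] by simp
  also have "\<dots> < k"
    using last_difference_entry_below[OF T_SCT S_SCT last_difference_sym[OF last]] T_k by simp
  finally show False .
qed

lemma last_difference_raising:
  assumes equiv: "(S, T) \<in> sct_equiv \<alpha>" and last: "last_difference \<alpha> S T k"
    and S_k: "cell_of \<alpha> S k = (r, q)" and left: "snd (cell_of \<alpha> T k) < q"
    and l_bounds: "k < l" "l < S (r, q - 1)" "q \<le> snd (cell_of \<alpha> S l)"
  shows "raising (cell_of \<alpha> T k) (cell_of \<alpha> T l)"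
proof -
  have S_SCT: "S \<in> SCT \<alpha>" and T_SCT: "T \<in> SCT \<alpha>" and k_range: "k \<in> {1..sum_list \<alpha>}"
    using sct_equiv_SCT[OF equiv] last_difference_range[OF last] by auto
  obtain r' q' where T_k: "cell_of \<alpha> T k = (r', q')"
    by fastforce
  obtain s p where S_l: "cell_of \<alpha> S l = (s, p)"
    by fastforce
  note S_cell = cell_of_eqD[OF S_SCT k_range S_k]
    and left_cell = last_difference_left_neighbour[OF S_SCT T_SCT last S_k left]
  have T_l: "cell_of \<alpha> T l = (s, p)" and l_cell: "(s, p) \<in> diagram \<alpha>" "S (s, p) = l"
    using last S_l cell_of_eqD[OF S_SCT _ S_l] k_range l_bounds left_cell(2)
    by (auto simp: last_difference_def)
  have "\<not> attacks (r', q') (s, p)"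
  proof
    assume "attacks (r', q') (s, p)"
    then have columns: "p = q" "q' = q - 1" and "r' < s"
      using left l_bounds(3) S_l T_k by auto
    then have "r < s"
      using last_difference_not_above[OF equiv last S_k] T_k by fastforce
    then have "S (s, q) < S (r, q)"
      using SCT_triple[OF S_SCT _ left_cell(1)] l_cell l_bounds(2) columns(1) by blast
    then show False
      using l_cell S_cell(2) l_bounds(1) columns(1) by simp
  qed
  then show ?thesis
    using left l_bounds(3) T_k T_l S_l by (simp add: raising_def)
qed

lemma source_attack_ahead:
  assumes S_source: "source \<alpha> S" and equiv: "(S, T) \<in> sct_equiv \<alpha>"
    and last: "last_difference \<alpha> S T k" and Des_subset: "Des \<alpha> T \<subseteq> Des \<alpha> S"
    and S_k: "cell_of \<alpha> S k = (r, q)"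
  obtains g where "g \<in> {k<..sum_list \<alpha>}" "g < S (r, q - 1)"
    "attacks (cell_of \<alpha> S k) (cell_of \<alpha> S g)"
    "\<And>h. h \<in> {k..g} \<Longrightarrow> q \<le> snd (cell_of \<alpha> S h)"
proof -
  have S_SCT: "S \<in> SCT \<alpha>" and T_SCT: "T \<in> SCT \<alpha>" and k_range: "k \<in> {1..sum_list \<alpha>}"
    using sct_equiv_SCT[OF equiv] last_difference_range[OF last] by auto
  have left: "snd (cell_of \<alpha> T k) < q"
    using source_last_difference_column[OF S_source equiv last] S_k by simp
  note left_cell = last_difference_left_neighbour[OF S_SCT T_SCT last S_k left]
  obtain p where q_Suc: "q = Suc p"
    using left by (cases q) auto
  define m where "m = S (r, p)"
  have m_bounds: "k < m" "m \<le> sum_list \<alpha>" and S_m: "cell_of \<alpha> S m = (r, p)"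
    using left_cell S_SCT q_Suc by (auto simp: m_def)
  have "1 \<le> k" "p < snd (cell_of \<alpha> S k)" "snd (cell_of \<alpha> S m) \<le> p"
    using k_range S_k S_m q_Suc by auto
  then obtain g s where g_range: "g \<in> {k..<m}" and S_g: "cell_of \<alpha> S g = (s, q)"
    and S_Suc_g: "cell_of \<alpha> S (Suc g) = (s, p)"
    and right: "\<And>h. h \<in> {k..g} \<Longrightarrow> p < snd (cell_of \<alpha> S h)"
    using source_column_drop[OF S_source _ m_bounds] q_Suc by metis
  have "g \<noteq> k"
  proof
    assume "g = k"
    then have "k \<notin> Des \<alpha> T"
      using Des_subset S_k S_Suc_g q_Suc by (auto simp: Des_iff fixing_def)
    moreover have "cell_of \<alpha> T (Suc k) = (s, p)"
      using last S_Suc_g \<open>g = k\<close> m_bounds by (simp add: last_difference_def)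
    ultimately show False
      using left k_range m_bounds q_Suc by (simp add: Des_iff fixing_def)
  qed
  then have "cell_of \<alpha> S k \<noteq> cell_of \<alpha> S g"
    using g_range k_range m_bounds by (simp add: cell_of_eq_iff[OF S_SCT])
  then have "attacks (cell_of \<alpha> S k) (cell_of \<alpha> S g)"
    using attacks_same_column S_k S_g by simp
  then show thesis
    using that[of g] right g_range \<open>g \<noteq> k\<close> m_bounds(2) q_Suc by (auto simp: m_def Suc_le_eq)
qed

lemma source_killing_ahead:
  assumes S_source: "source \<alpha> S" and equiv: "(S, T) \<in> sct_equiv \<alpha>"
    and last: "last_difference \<alpha> S T k" and Des_subset: "Des \<alpha> T \<subseteq> Des \<alpha> S"
  obtains j where "j \<in> {k<..sum_list \<alpha>}" "killing (cell_of \<alpha> S k) (cell_of \<alpha> S j)"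
    "\<And>l. l \<in> {k<..<j} \<Longrightarrow> raising (cell_of \<alpha> S k) (cell_of \<alpha> S l)"
    "\<And>l. l \<in> {k<..j} \<Longrightarrow> raising (cell_of \<alpha> T k) (cell_of \<alpha> T l)"
proof -
  have S_SCT: "S \<in> SCT \<alpha>" and k_range: "k \<in> {1..sum_list \<alpha>}"
    using source_SCT[OF S_source] last_difference_range[OF last] by auto
  obtain r q where S_k: "cell_of \<alpha> S k = (r, q)"
    by fastforce
  obtain g where g_attacked: "g \<in> {k<..sum_list \<alpha>}" "g < S (r, q - 1)"
      "attacks (cell_of \<alpha> S k) (cell_of \<alpha> S g)"
    and right: "\<And>h. h \<in> {k..g} \<Longrightarrow> q \<le> snd (cell_of \<alpha> S h)"
    using source_attack_ahead[OF S_source equiv last Des_subset S_k] by blast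
  obtain j where j_attacked: "j \<le> g" "k < j" "attacks (cell_of \<alpha> S k) (cell_of \<alpha> S j)"
    and first: "\<And>l. \<lbrakk>k < l; l < j\<rbrakk> \<Longrightarrow> \<not> attacks (cell_of \<alpha> S k) (cell_of \<alpha> S l)"
    using ex_least_nat_le[of "\<lambda>j. k < j \<and> attacks (cell_of \<alpha> S k) (cell_of \<alpha> S j)" g] g_attacked
    by auto
  have T_raising: "raising (cell_of \<alpha> T k) (cell_of \<alpha> T l)" if "l \<in> {k<..j}" for l
    using last_difference_raising[OF equiv last S_k _ _ _ right] g_attacked(2) j_attacked(1) that
      source_last_difference_column[OF S_source equiv last] S_k by simp
  show thesis
  proof (rule that[OF _ _ _ T_raising])
    show j_range: "j \<in> {k<..sum_list \<alpha>}"
      using j_attacked(1,2) g_attacked(1) by simp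
    show "killing (cell_of \<alpha> S k) (cell_of \<alpha> S j)"
      using j_attacked right[of j] S_k by (simp add: killing_def)
    fix l assume l_range: "l \<in> {k<..<j}"
    then have "cell_of \<alpha> S k \<noteq> cell_of \<alpha> S l"
      using k_range j_range by (simp add: cell_of_eq_iff[OF S_SCT])
    moreover have "snd (cell_of \<alpha> S k) \<le> snd (cell_of \<alpha> S l)"
      using right[of l] l_range j_attacked(1) S_k by simp
    ultimately show "raising (cell_of \<alpha> S k) (cell_of \<alpha> S l)"
      using first[of l] l_range attacks_same_column[of "cell_of \<alpha> S k" "cell_of \<alpha> S l"]
      by (auto simp: raising_def le_less)
  qed
qed

subsection \<open>The operators on tableaux satisfy the Hecke relations\<close>

lemma clinear_pi_op: "clinear (pi_op \<alpha> i)"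
  unfolding pi_op_def by (rule clinear_lin_ext)

abbreviation pi_word :: "nat list \<Rightarrow> nat list \<Rightarrow> (tableau \<Rightarrow>\<^sub>0 complex) \<Rightarrow> (tableau \<Rightarrow>\<^sub>0 complex)" where
  "pi_word \<alpha> \<equiv> foldr (pi_op \<alpha>)"

lemma clinear_pi_word: "clinear (pi_word \<alpha> ws)"
  by (induction ws)
    (auto intro: formal.linear_ident clinear_compose[OF _ clinear_pi_op] simp: comp_def id_def)

lemma pi_op_basis:
  "pi_op \<alpha> i (basis T) =
     (if i \<in> ADes \<alpha> T then 0 else if i \<in> nADes \<alpha> T then basis (swap_entries \<alpha> i T) else basis T)"
  by (simp add: pi_op_def pi_tab_def)

lemma pi_op_fixing:
  "fixing (cell_of \<alpha> T i) (cell_of \<alpha> T (Suc i)) \<Longrightarrow> pi_op \<alpha> i (basis T) = basis T"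
  by (simp add: pi_op_basis nADes_def ADes_def Des_iff)

lemma pi_op_killing:
  "\<lbrakk>i \<in> {1..<sum_list \<alpha>}; killing (cell_of \<alpha> T i) (cell_of \<alpha> T (Suc i))\<rbrakk>
     \<Longrightarrow> pi_op \<alpha> i (basis T) = 0"
  by (simp add: pi_op_basis ADes_iff)

lemma pi_op_nADes: "i \<in> nADes \<alpha> T \<Longrightarrow> pi_op \<alpha> i (basis T) = basis (swap_entries \<alpha> i T)"
  by (simp add: pi_op_basis nADes_def)

lemma pi_op_raising:
  "\<lbrakk>T \<in> SCT \<alpha>; i \<in> {1..<sum_list \<alpha>}; raising (cell_of \<alpha> T i) (cell_of \<alpha> T (Suc i))\<rbrakk>
     \<Longrightarrow> pi_op \<alpha> i (basis T) = basis (swap_entries \<alpha> i T)"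
  by (simp add: pi_op_nADes nADes_iff)

lemmas pi_op_simps = pi_op_fixing pi_op_killing pi_op_raising
  formal_pair.linear_0[OF clinear_pi_op] swap_raising_SCT cell_of_swap_raising raising_imp_fixing

lemma pi_op_idem_basis:
  assumes T_SCT: "T \<in> SCT \<alpha>" and i_range: "i \<in> {1..<sum_list \<alpha>}"
  shows "pi_word \<alpha> [i, i] (basis T) = pi_word \<alpha> [i] (basis T)"
proof -
  have "cell_of \<alpha> T i \<noteq> cell_of \<alpha> T (Suc i)"
    using i_range by (simp add: cell_of_eq_iff[OF T_SCT])
  then show ?thesis
    using T_SCT i_range by (cases rule: fixing_killing_raising) (simp_all add: pi_op_simps)
qed

lemma pi_op_commute_basis:
  assumes T_SCT: "T \<in> SCT \<alpha>" and i_range: "i \<in> {1..<sum_list \<alpha>}" and j_range: "j \<in> {1..<sum_list \<alpha>}"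
    and far: "Suc i < j \<or> Suc j < i"
  shows "pi_word \<alpha> [i, j] (basis T) = pi_word \<alpha> [j, i] (basis T)"
proof -
  have swap: "swap_entries \<alpha> i (swap_entries \<alpha> j T) = swap_entries \<alpha> j (swap_entries \<alpha> i T)"
    using far by (auto simp: swap_entries_def fun_eq_iff transpose_def)
  have transpose: "transpose i (Suc i) j = j" "transpose i (Suc i) (Suc j) = Suc j"
    "transpose j (Suc j) i = i" "transpose j (Suc j) (Suc i) = Suc i"
    using far by (auto simp: transpose_def)
  have "cell_of \<alpha> T i \<noteq> cell_of \<alpha> T (Suc i)" "cell_of \<alpha> T j \<noteq> cell_of \<alpha> T (Suc j)"
    using i_range j_range by (simp_all add: cell_of_eq_iff[OF T_SCT])
  then show ?thesis
    using T_SCT i_range j_range swap transpose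
    by (elim fixing_killing_raising) (simp_all add: pi_op_simps)
qed

lemma pi_op_braid_basis:
  assumes T_SCT: "T \<in> SCT \<alpha>" and i_range: "i \<in> {1..<sum_list \<alpha>}" "Suc i \<in> {1..<sum_list \<alpha>}"
  shows "pi_word \<alpha> [i, Suc i, i] (basis T) = pi_word \<alpha> [Suc i, i, Suc i] (basis T)"
proof -
  have swap: "swap_entries \<alpha> i (swap_entries \<alpha> (Suc i) (swap_entries \<alpha> i T)) =
        swap_entries \<alpha> (Suc i) (swap_entries \<alpha> i (swap_entries \<alpha> (Suc i) T))"
    by (auto simp: swap_entries_def fun_eq_iff transpose_def)
  have transpose: "transpose i (Suc i) (Suc (Suc i)) = Suc (Suc i)"
    "transpose (Suc i) (Suc (Suc i)) i = i"
    by (auto simp: transpose_def)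
  define x y z where cells: "x = cell_of \<alpha> T i" "y = cell_of \<alpha> T (Suc i)"
    "z = cell_of \<alpha> T (Suc (Suc i))"
  have "x \<noteq> y" "x \<noteq> z" "y \<noteq> z"
    using i_range by (simp_all add: cells cell_of_eq_iff[OF T_SCT])
  moreover have "\<not> fixing x z" if "killing x y \<or> raising x y" "killing y z \<or> raising y z"
    using that by (auto simp: fixing_def killing_def raising_def)
  ultimately show ?thesis
    using T_SCT i_range swap transpose
    by (elim fixing_killing_raising) (simp_all add: pi_op_simps cells[symmetric])
qed

lemma pi_word_eq_on_formal_span:
  assumes "v \<in> formal_span S" "\<And>T. T \<in> S \<Longrightarrow> pi_word \<alpha> ws (basis T) = pi_word \<alpha> ws' (basis T)"
  shows "pi_word \<alpha> ws v = pi_word \<alpha> ws' v"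
  by (rule clinear_eq_on_formal_span[OF clinear_pi_word clinear_pi_word assms])

definition swap_closed :: "nat list \<Rightarrow> tableau set \<Rightarrow> bool" where
  "swap_closed \<alpha> S \<longleftrightarrow> S \<subseteq> SCT \<alpha> \<and> (\<forall>T\<in>S. \<forall>i\<in>nADes \<alpha> T. swap_entries \<alpha> i T \<in> S)"

lemma swap_closed_SCT: "swap_closed \<alpha> (SCT \<alpha>)"
  using swap_raising_SCT nADes_iff by (auto simp: swap_closed_def)

lemma pi_op_in_formal_span:
  assumes "swap_closed \<alpha> S" "v \<in> formal_span S"
  shows "pi_op \<alpha> i v \<in> formal_span S"
proof (rule clinear_maps_formal_span[OF clinear_pi_op assms(2)])
  fix T assume "T \<in> S"
  then show "pi_op \<alpha> i (basis T) \<in> formal_span S"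
    using assms(1) by (simp add: pi_op_basis swap_closed_def basis_in_formal_span formal.span_zero)
qed

lemma pi_word_in_formal_span:
  "\<lbrakk>swap_closed \<alpha> S; v \<in> formal_span S\<rbrakk> \<Longrightarrow> pi_word \<alpha> ws v \<in> formal_span S"
  by (induction ws) (auto intro: pi_op_in_formal_span)

subsection \<open>Leading coefficients along raising paths\<close>

lemma pi_word_raising_path:
  "raising_path \<alpha> T ws U \<Longrightarrow> pi_word \<alpha> ws (basis T) = basis U"
  by (induction rule: raising_path.induct) (simp_all add: pi_op_nADes)

definition SCT_invs_le :: "nat list \<Rightarrow> nat \<Rightarrow> tableau set" where
  "SCT_invs_le \<alpha> m = {T \<in> SCT \<alpha>. card (invs \<alpha> T) \<le> m}"

lemma pi_op_invs_le:
  assumes "v \<in> formal_span (SCT_invs_le \<alpha> m)"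
  shows "pi_op \<alpha> i v \<in> formal_span (SCT_invs_le \<alpha> (Suc m))"
proof (rule clinear_maps_formal_span[OF clinear_pi_op assms])
  fix T assume "T \<in> SCT_invs_le \<alpha> m"
  then have "T \<in> SCT_invs_le \<alpha> (Suc m)"
    and "i \<in> nADes \<alpha> T \<Longrightarrow> swap_entries \<alpha> i T \<in> SCT_invs_le \<alpha> (Suc m)"
    using card_invs_swap[of T \<alpha> i] swap_closed_SCT by (auto simp: SCT_invs_le_def swap_closed_def)
  then show "pi_op \<alpha> i (basis T) \<in> formal_span (SCT_invs_le \<alpha> (Suc m))"
    by (simp add: pi_op_basis basis_in_formal_span formal.span_zero)
qed

lemma lookup_pi_op_leading:
  assumes T_SCT: "T \<in> SCT \<alpha>" and i_nADes: "i \<in> nADes \<alpha> T"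
    and v_span: "v \<in> formal_span (SCT_invs_le \<alpha> (card (invs \<alpha> T)))"
  shows "Poly_Mapping.lookup (pi_op \<alpha> i v) (swap_entries \<alpha> i T) = Poly_Mapping.lookup v T"
proof -
  let ?S = "SCT_invs_le \<alpha> (card (invs \<alpha> T))" and ?T' = "swap_entries \<alpha> i T"
  let ?V = "{v. Poly_Mapping.lookup (pi_op \<alpha> i v) ?T' = Poly_Mapping.lookup v T}"
  have "basis U \<in> ?V" if "U \<in> ?S" for U
  proof -
    have U_SCT: "U \<in> SCT \<alpha>" and "U \<noteq> ?T'"
      using that card_invs_swap[OF T_SCT i_nADes] by (auto simp: SCT_invs_le_def)
    moreover have "swap_entries \<alpha> i U = ?T' \<longleftrightarrow> U = T"
      using swap_entries_swap_entries[OF T_SCT] swap_entries_swap_entries[OF U_SCT] by metis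
    moreover have "U \<noteq> T" if "i \<notin> nADes \<alpha> U"
      using i_nADes that by blast
    ultimately show ?thesis
      by (cases "i \<in> nADes \<alpha> U") (auto simp: pi_op_basis lookup_single nADes_def)
  qed
  moreover have "formal.subspace ?V"
    by (rule formal.subspaceI)
      (simp_all add: lookup_add formal_pair.linear_0[OF clinear_pi_op]
        formal_pair.linear_add[OF clinear_pi_op] formal_pair.linear_scale[OF clinear_pi_op])
  ultimately have "formal_span ?S \<subseteq> ?V"
    by (intro formal.span_minimal) auto
  then show ?thesis
    using v_span by blast
qed

lemma lookup_pi_word_leading:
  assumes "raising_path \<alpha> T ws U" "v \<in> formal_span (SCT_invs_le \<alpha> (card (invs \<alpha> T)))"
  shows "Poly_Mapping.lookup (pi_word \<alpha> ws v) U = Poly_Mapping.lookup v T"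
proof -
  have "pi_word \<alpha> ws v \<in> formal_span (SCT_invs_le \<alpha> (card (invs \<alpha> U))) \<and>
      Poly_Mapping.lookup (pi_word \<alpha> ws v) U = Poly_Mapping.lookup v T"
    using assms
  proof (induction rule: raising_path.induct)
    case (Cons ws U i)
    have U_SCT: "U \<in> SCT \<alpha>"
      by (rule raising_path_SCT[OF Cons.hyps(1)])
    show ?case
      using Cons.IH[OF Cons.prems] pi_op_invs_le card_invs_swap[OF U_SCT Cons.hyps(2)]
        lookup_pi_op_leading[OF U_SCT Cons.hyps(2)] by simp
  qed simp
  then show ?thesis
    by simp
qed

lemma leading_tableau_exists:
  assumes "v \<in> formal_span (SCT \<alpha>)" "v \<noteq> 0"
  obtains T where "T \<in> Poly_Mapping.keys v"
    "v \<in> formal_span (SCT_invs_le \<alpha> (card (invs \<alpha> T)))"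
proof -
  let ?invs = "\<lambda>U. card (invs \<alpha> U)"
  obtain T where T_key: "T \<in> Poly_Mapping.keys v"
    and T_max: "Max (?invs ` Poly_Mapping.keys v) = ?invs T"
    using assms(2) by (metis obtains_MAX[OF finite_keys] keys_eq_empty)
  have "?invs U \<le> ?invs T" if "U \<in> Poly_Mapping.keys v" for U
    using that unfolding T_max[symmetric] by simp
  then have "v \<in> formal_span (SCT_invs_le \<alpha> (?invs T))"
    using assms(1) by (auto simp: formal_span_iff SCT_invs_le_def)
  then show thesis
    using that T_key by blast
qed

lemma source_separating_word:
  assumes S_source: "source \<alpha> S" and equiv: "(S, T) \<in> sct_equiv \<alpha>" and "T \<noteq> S"
    and Des_subset: "Des \<alpha> T \<subseteq> Des \<alpha> S"
  obtains ws U where "raising_path \<alpha> T ws U" "pi_word \<alpha> ws (basis S) = 0"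
proof -
  have S_SCT: "S \<in> SCT \<alpha>" and T_SCT: "T \<in> SCT \<alpha>"
    using sct_equiv_SCT[OF equiv] by auto
  obtain k where last: "last_difference \<alpha> S T k"
    using last_difference_exists[OF S_SCT T_SCT] \<open>T \<noteq> S\<close> by metis
  obtain j where j_range: "j \<in> {k<..sum_list \<alpha>}"
    and killing: "killing (cell_of \<alpha> S k) (cell_of \<alpha> S j)"
    and S_raising: "\<And>l. l \<in> {k<..<j} \<Longrightarrow> raising (cell_of \<alpha> S k) (cell_of \<alpha> S l)"
    and T_raising: "\<And>l. l \<in> {k<..j} \<Longrightarrow> raising (cell_of \<alpha> T k) (cell_of \<alpha> T l)"
    by (rule source_killing_ahead[OF S_source equiv last Des_subset]) blast
  obtain i where j_Suc: "j = Suc i" "k \<le> i"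
    using j_range by (cases j) auto
  have range: "1 \<le> k" "k \<le> j" "j \<le> sum_list \<alpha>" "i \<in> {1..<sum_list \<alpha>}"
    using last_difference_range[OF last] j_Suc j_range by auto
  obtain U where U_path: "raising_path \<alpha> T (rev [k..<j]) U"
    using raising_path_upt[OF T_SCT range(1-3) T_raising] by blast
  have "i \<le> sum_list \<alpha>"
    and "\<And>l. l \<in> {k<..i} \<Longrightarrow> raising (cell_of \<alpha> S k) (cell_of \<alpha> S l)"
    using S_raising j_Suc(1) range(4) by auto
  then obtain V where V_path: "raising_path \<alpha> S (rev [k..<i]) V" "cell_of \<alpha> V i = cell_of \<alpha> S k"
    and above: "\<And>l. l \<in> {i<..sum_list \<alpha>} \<Longrightarrow> cell_of \<alpha> V l = cell_of \<alpha> S l"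
    using raising_path_upt[OF S_SCT range(1) j_Suc(2)] by blast
  have "pi_op \<alpha> i (basis V) = 0"
    using killing V_path(2) above[of j] j_Suc(1) range(4) by (intro pi_op_killing) auto
  then have "pi_word \<alpha> (rev [k..<j]) (basis S) = 0"
    using pi_word_raising_path[OF V_path(1)] j_Suc by simp
  then show thesis
    using that[OF U_path] by blast
qed

subsection \<open>The action of the free algebra\<close>

lemma clinear_free_act_left: "clinear (\<lambda>p. free_act \<alpha> p v)"
  unfolding free_act_def by (rule clinear_lin_ext)

lemmas free_act_add_left = formal_pair.linear_add[OF clinear_free_act_left]
  and free_act_diff_left = formal_pair.linear_diff[OF clinear_free_act_left]
  and free_act_neg_left = formal_pair.linear_neg[OF clinear_free_act_left]
  and free_act_zero_left = formal_pair.linear_0[OF clinear_free_act_left]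

lemma clinear_free_act: "clinear (free_act \<alpha> p)"
  by (rule clinearI)
    (simp_all add: free_act_def lin_ext_def formal_pair.linear_add[OF clinear_pi_word]
      formal_pair.linear_scale[OF clinear_pi_word] formal.scale_right_distrib sum.distrib
      formal.scale_sum_right mult.commute)

lemma free_act_single:
  "free_act \<alpha> (Poly_Mapping.single w c) v = cscale c (pi_word \<alpha> (letters w) v)"
  by (simp add: free_act_def)

lemma free_act_gen: "free_act \<alpha> (gen i) v = pi_op \<alpha> i v"
  by (simp add: gen_def free_act_single)

lemma free_act_scalar: "free_act \<alpha> (Poly_Mapping.single 0 c) v = cscale c v"
  by (simp add: free_act_single zero_word_def)

lemma free_act_one: "free_act \<alpha> 1 v = v"
  using free_act_scalar[of \<alpha> 1 v] by simp

lemma cscale_conv_mult: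
  fixes v :: "'a :: monoid_add \<Rightarrow>\<^sub>0 complex"
  shows "cscale c v = Poly_Mapping.single 0 c * v"
  by (simp add: cscale_def mult_map_scale_conv_mult)

lemma clinear_mult_right: "clinear (\<lambda>p :: 'a :: monoid_add \<Rightarrow>\<^sub>0 complex. p * q)"
  by (rule clinearI) (simp_all add: distrib_right cscale_conv_mult mult.assoc)

lemma clinear_basis_mult: "clinear (\<lambda>q :: 'a :: monoid_add \<Rightarrow>\<^sub>0 complex. basis u * q)"
  by (rule clinearI) (simp_all add: distrib_left cscale_conv_mult mult.assoc[symmetric] mult_single)

lemma free_act_mult: "free_act \<alpha> (p * q) v = free_act \<alpha> p (free_act \<alpha> q v)"
proof -
  have basis: "free_act \<alpha> (basis u * q) v = free_act \<alpha> (basis u) (free_act \<alpha> q v)" for u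
  proof (rule clinear_eq_on_formal_span[of "\<lambda>q. free_act \<alpha> (basis u * q) v" _ q UNIV])
    show "clinear (\<lambda>q. free_act \<alpha> (basis u * q) v)"
      by (rule clinear_compose[OF clinear_basis_mult clinear_free_act_left])
    show "clinear (\<lambda>q. free_act \<alpha> (basis u) (free_act \<alpha> q v))"
      by (rule clinear_compose[OF clinear_free_act_left clinear_free_act])
    show "free_act \<alpha> (basis u * basis w) v = free_act \<alpha> (basis u) (free_act \<alpha> (basis w) v)" for w
      by (simp add: mult_single free_act_single plus_word_def)
  qed (simp add: formal_span_iff)
  show ?thesis
  proof (rule clinear_eq_on_formal_span[of "\<lambda>p. free_act \<alpha> (p * q) v" _ p UNIV])
    show "clinear (\<lambda>p. free_act \<alpha> (p * q) v)"
      by (rule clinear_compose[OF clinear_mult_right clinear_free_act_left])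
  qed (simp_all add: clinear_free_act_left basis formal_span_iff)
qed

lemma free_act_in_formal_span:
  "\<lbrakk>swap_closed \<alpha> S; v \<in> formal_span S\<rbrakk> \<Longrightarrow> free_act \<alpha> p v \<in> formal_span S"
  unfolding free_act_def lin_ext_def
  by (intro formal.span_sum formal.span_scale pi_word_in_formal_span)

lemma free_alg_simps [simp]:
  "mult (free_alg n) = (*)" "one (free_alg n) = 1" "zero (free_alg n) = 0" "add (free_alg n) = (+)"
  by (simp_all add: free_alg_def)

lemma carrier_free_alg:
  "carrier (free_alg n) = formal_span {w. set (letters w) \<subseteq> {1..<n}}"
  by (simp add: set_eq_iff free_alg_def formal_span_iff subset_iff Ball_def)

lemma free_alg_mult_closed:
  assumes "p \<in> carrier (free_alg n)" "q \<in> carrier (free_alg n)"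
  shows "p * q \<in> carrier (free_alg n)"
proof -
  have "set (letters w) \<subseteq> {1..<n}" if w_key: "w \<in> Poly_Mapping.keys (p * q)" for w
  proof -
    obtain u u' where "w = u + u'" "u \<in> Poly_Mapping.keys p" "u' \<in> Poly_Mapping.keys q"
      using subsetD[OF keys_mult w_key] by blast
    then show ?thesis
      using assms by (auto simp: free_alg_def plus_word_def)
  qed
  then show ?thesis
    by (simp add: free_alg_def)
qed

lemma free_alg_scalar_closed: "Poly_Mapping.single 0 c \<in> carrier (free_alg n)"
  by (auto simp: free_alg_def zero_word_def)

lemma free_alg_one_closed: "1 \<in> carrier (free_alg n)"
  using free_alg_scalar_closed[of 1] by simp

lemma free_alg_gen_closed: "i \<in> {1..<n} \<Longrightarrow> gen i \<in> carrier (free_alg n)"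
  by (simp add: free_alg_def gen_def)

lemma ring_free_alg: "ring (free_alg n)"
proof (rule ringI)
  show "abelian_group (free_alg n)"
  proof (rule abelian_groupI)
    fix p assume "p \<in> carrier (free_alg n)"
    then show "\<exists>q\<in>carrier (free_alg n). q \<oplus>\<^bsub>free_alg n\<^esub> p = \<zero>\<^bsub>free_alg n\<^esub>"
      by (intro bexI[of _ "- p"]) (simp_all add: carrier_free_alg formal.span_neg)
  qed (simp_all add: carrier_free_alg formal.span_zero formal.span_add add.assoc add.commute)
  show "Group.monoid (free_alg n)"
    by (intro monoidI) (simp_all add: free_alg_mult_closed free_alg_one_closed mult.assoc)
qed (simp_all add: algebra_simps)

lemma free_alg_a_inv:
  assumes "p \<in> carrier (free_alg n)"
  shows "\<ominus>\<^bsub>free_alg n\<^esub> p = - p"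
proof -
  interpret ring "free_alg n"
    by (rule ring_free_alg)
  show ?thesis
    using assms by (intro minus_equality) (simp_all add: carrier_free_alg formal.span_neg)
qed

definition annihilator :: "nat list \<Rightarrow> (word \<Rightarrow>\<^sub>0 complex) set" where
  "annihilator \<alpha> =
     {p \<in> carrier (free_alg (sum_list \<alpha>)). \<forall>v\<in>formal_span (SCT \<alpha>). free_act \<alpha> p v = 0}"

lemma ideal_annihilator: "ideal (annihilator \<alpha>) (free_alg (sum_list \<alpha>))"
proof (rule idealI)
  let ?F = "free_alg (sum_list \<alpha>)"
  interpret ring ?F
    by (rule ring_free_alg)
  show "subgroup (annihilator \<alpha>) (add_monoid ?F)"
  proof (rule add.subgroupI)
    show "annihilator \<alpha> \<noteq> {}"
      using zero_closed by (auto simp: annihilator_def free_act_zero_left)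
    show "\<ominus>\<^bsub>?F\<^esub> p \<in> annihilator \<alpha>" if "p \<in> annihilator \<alpha>" for p
      using that a_inv_closed[of p] by (simp add: annihilator_def free_alg_a_inv free_act_neg_left)
    show "p \<oplus>\<^bsub>?F\<^esub> q \<in> annihilator \<alpha>" if "p \<in> annihilator \<alpha>" "q \<in> annihilator \<alpha>" for p q
      using that a_closed[of p q] by (simp add: annihilator_def free_act_add_left)
  qed (auto simp: annihilator_def)
  fix a p assume "a \<in> annihilator \<alpha>" "p \<in> carrier ?F"
  then show "p \<otimes>\<^bsub>?F\<^esub> a \<in> annihilator \<alpha>" "a \<otimes>\<^bsub>?F\<^esub> p \<in> annihilator \<alpha>"
    using free_act_in_formal_span[OF swap_closed_SCT] formal_pair.linear_0[OF clinear_free_act]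
    by (simp_all add: annihilator_def free_act_mult free_alg_mult_closed)
qed (rule ring_free_alg)

lemma hecke_rels_closed: "hecke_rels n \<subseteq> carrier (free_alg n)"
proof -
  have "p - q \<in> carrier (free_alg n)"
    if "p \<in> carrier (free_alg n)" "q \<in> carrier (free_alg n)" for p q
    using that unfolding carrier_free_alg by (rule formal.span_diff)
  then show ?thesis
    using free_alg_gen_closed free_alg_mult_closed by (auto simp: hecke_rels_def)
qed

lemma hecke_rels_annihilate: "hecke_rels (sum_list \<alpha>) \<subseteq> annihilator \<alpha>"
proof
  fix p assume p_rel: "p \<in> hecke_rels (sum_list \<alpha>)"
  have "free_act \<alpha> p v = 0" if v_span: "v \<in> formal_span (SCT \<alpha>)" for v
  proof -
    note word_eq = pi_word_eq_on_formal_span[OF v_span]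
    from p_rel consider (idem) i where "i \<in> {1..<sum_list \<alpha>}" "p = gen i * gen i - gen i"
      | (braid) i where "i \<in> {1..<sum_list \<alpha>}" "Suc i \<in> {1..<sum_list \<alpha>}"
        "p = gen i * gen (Suc i) * gen i - gen (Suc i) * gen i * gen (Suc i)"
      | (commute) i j where "i \<in> {1..<sum_list \<alpha>}" "j \<in> {1..<sum_list \<alpha>}"
        "\<bar>int i - int j\<bar> \<ge> 2" "p = gen i * gen j - gen j * gen i"
      unfolding hecke_rels_def by auto
    then show ?thesis
    proof cases
      case idem
      then show ?thesis
        using word_eq[OF pi_op_idem_basis]
        by (simp add: free_act_diff_left free_act_mult free_act_gen)
    next
      case braid
      then show ?thesis
        using word_eq[OF pi_op_braid_basis]
        by (simp add: free_act_diff_left free_act_mult free_act_gen)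
    next
      case commute
      then have "Suc i < j \<or> Suc j < i"
        by linarith
      then show ?thesis
        using commute word_eq[OF pi_op_commute_basis[where i = i and j = j]]
        by (simp add: free_act_diff_left free_act_mult free_act_gen)
    qed
  qed
  then show "p \<in> annihilator \<alpha>"
    using p_rel hecke_rels_closed by (auto simp: annihilator_def)
qed

subsection \<open>The module of an equivalence class\<close>

abbreviation hecke_ideal :: "nat \<Rightarrow> (word \<Rightarrow>\<^sub>0 complex) set" where
  "hecke_ideal n \<equiv> Idl\<^bsub>free_alg n\<^esub> (hecke_rels n)"

abbreviation hecke_class :: "nat \<Rightarrow> (word \<Rightarrow>\<^sub>0 complex) \<Rightarrow> (word \<Rightarrow>\<^sub>0 complex) set" where
  "hecke_class n p \<equiv> hecke_ideal n +>\<^bsub>free_alg n\<^esub> p"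

lemma ideal_hecke_ideal: "ideal (hecke_ideal n) (free_alg n)"
  by (rule ring.genideal_ideal[OF ring_free_alg hecke_rels_closed])

lemma hecke_ideal_annihilates: "hecke_ideal (sum_list \<alpha>) \<subseteq> annihilator \<alpha>"
  by (rule ring.genideal_minimal[OF ring_free_alg ideal_annihilator hecke_rels_annihilate])

lemma ring_hecke0: "ring (hecke0 n)"
  unfolding hecke0_def by (rule ideal.quotient_is_ring[OF ideal_hecke_ideal])

lemma hecke_class_hom: "hecke_class n \<in> ring_hom (free_alg n) (hecke0 n)"
  unfolding hecke0_def by (rule ideal.rcos_ring_hom[OF ideal_hecke_ideal])

lemma hecke_class_closed: "p \<in> carrier (free_alg n) \<Longrightarrow> hecke_class n p \<in> carrier (hecke0 n)"
  by (rule ring_hom_closed[OF hecke_class_hom])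

lemma hecke_class_cases:
  assumes "X \<in> carrier (hecke0 n)"
  obtains p where "p \<in> carrier (free_alg n)" "X = hecke_class n p"
  using assms unfolding hecke0_def FactRing_simps by auto

lemma S_module_simps [simp]:
  "carrier (S_module \<alpha> E) = formal_span E" "zero (S_module \<alpha> E) = 0" "add (S_module \<alpha> E) = (+)"
  by (auto simp: S_module_def formal_span_iff)

lemma abelian_group_S_module: "abelian_group (S_module \<alpha> E)"
proof (rule abelian_groupI)
  fix v assume "v \<in> carrier (S_module \<alpha> E)"
  then show "\<exists>u\<in>carrier (S_module \<alpha> E). u \<oplus>\<^bsub>S_module \<alpha> E\<^esub> v = \<zero>\<^bsub>S_module \<alpha> E\<^esub>"
    by (intro bexI[of _ "- v"]) (auto intro: formal.span_neg)
qed (auto simp: formal.span_zero formal.span_add add.assoc add.commute)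

lemma smult_hecke_class:
  assumes closed: "swap_closed \<alpha> E"
    and p_carrier: "p \<in> carrier (free_alg (sum_list \<alpha>))" and "v \<in> formal_span E"
  shows "hecke_class (sum_list \<alpha>) p \<odot>\<^bsub>S_module \<alpha> E\<^esub> v = free_act \<alpha> p v"
proof -
  interpret ideal "hecke_ideal (sum_list \<alpha>)" "free_alg (sum_list \<alpha>)"
    by (rule ideal_hecke_ideal)
  have v_span: "v \<in> formal_span (SCT \<alpha>)"
    using assms(3) formal_span_mono[of E "SCT \<alpha>"] closed by (auto simp: swap_closed_def)
  have "free_act \<alpha> q v = free_act \<alpha> p v" if q_class: "q \<in> hecke_class (sum_list \<alpha>) p" for q
  proof -
    obtain h where "h \<in> hecke_ideal (sum_list \<alpha>)" "q = h + p"
      using q_class by (auto simp: a_r_coset_def r_coset_def)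
    then show ?thesis
      using hecke_ideal_annihilates v_span by (auto simp: free_act_add_left annihilator_def)
  qed
  moreover have "p \<in> hecke_class (sum_list \<alpha>) p"
    by (rule a_rcos_self[OF p_carrier])
  ultimately have "(\<lambda>q. free_act \<alpha> q v) ` hecke_class (sum_list \<alpha>) p = {free_act \<alpha> p v}"
    by blast
  then show ?thesis
    by (simp add: S_module_def)
qed

lemma left_module_S_module:
  assumes closed: "swap_closed \<alpha> E"
  shows "left_module (hecke0 (sum_list \<alpha>)) (S_module \<alpha> E)"
proof -
  let ?H = "hecke0 (sum_list \<alpha>)" and ?M = "S_module \<alpha> E" and ?F = "free_alg (sum_list \<alpha>)"
  note act = smult_hecke_class[OF closed]
  note in_span = free_act_in_formal_span[OF closed]
  have "left_module_axioms ?H ?M"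
  proof
    fix X u assume X_carrier: "X \<in> carrier ?H" and u_carrier: "u \<in> carrier ?M"
    obtain p where X_class: "p \<in> carrier ?F" "X = hecke_class (sum_list \<alpha>) p"
      using X_carrier by (rule hecke_class_cases)
    show "X \<odot>\<^bsub>?M\<^esub> u \<in> carrier ?M"
      using X_class u_carrier in_span by (simp add: act)
    show "X \<odot>\<^bsub>?M\<^esub> (u \<oplus>\<^bsub>?M\<^esub> v) = X \<odot>\<^bsub>?M\<^esub> u \<oplus>\<^bsub>?M\<^esub> X \<odot>\<^bsub>?M\<^esub> v" if "v \<in> carrier ?M" for v
      using X_class u_carrier that
      by (simp add: act formal.span_add formal_pair.linear_add[OF clinear_free_act])
    fix Y assume Y_carrier: "Y \<in> carrier ?H"
    obtain q where Y_class: "q \<in> carrier ?F" "Y = hecke_class (sum_list \<alpha>) q"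
      using Y_carrier by (rule hecke_class_cases)
    show "(X \<oplus>\<^bsub>?H\<^esub> Y) \<odot>\<^bsub>?M\<^esub> u = X \<odot>\<^bsub>?M\<^esub> u \<oplus>\<^bsub>?M\<^esub> Y \<odot>\<^bsub>?M\<^esub> u"
      using X_class Y_class u_carrier
        ring_hom_add[OF hecke_class_hom X_class(1) Y_class(1), symmetric]
        ring.ring_simprules(1)[OF ring_free_alg X_class(1) Y_class(1)]
      by (simp add: act free_act_add_left)
    show "(X \<otimes>\<^bsub>?H\<^esub> Y) \<odot>\<^bsub>?M\<^esub> u = X \<odot>\<^bsub>?M\<^esub> (Y \<odot>\<^bsub>?M\<^esub> u)"
      using X_class Y_class u_carrier in_span
        ring_hom_mult[OF hecke_class_hom X_class(1) Y_class(1), symmetric]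
      by (simp add: act free_alg_mult_closed free_act_mult)
  next
    fix u assume "u \<in> carrier ?M"
    then show "\<one>\<^bsub>?H\<^esub> \<odot>\<^bsub>?M\<^esub> u = u"
      using act[of 1 u] ring_hom_one[OF hecke_class_hom, of "sum_list \<alpha>"]
      by (simp add: free_alg_one_closed free_act_one)
  qed
  then show ?thesis
    using ring_hecke0 abelian_group_S_module by (intro left_module.intro)
qed

subsection \<open>Sources of equivalence classes\<close>

lemma class_in_SCT: "E \<in> sct_classes \<alpha> \<Longrightarrow> E \<subseteq> SCT \<alpha>"
  unfolding sct_classes_def using equiv_sct_equiv by (metis in_quotient_imp_subset)

lemma class_equiv: "\<lbrakk>E \<in> sct_classes \<alpha>; T \<in> E; U \<in> E\<rbrakk> \<Longrightarrow> (T, U) \<in> sct_equiv \<alpha>"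
  unfolding sct_classes_def using equiv_sct_equiv by (metis quotient_eq_iff)

lemma class_closed: "\<lbrakk>E \<in> sct_classes \<alpha>; T \<in> E; (T, U) \<in> sct_equiv \<alpha>\<rbrakk> \<Longrightarrow> U \<in> E"
  unfolding sct_classes_def using equiv_sct_equiv by (metis in_quotient_imp_closed)

lemma swap_closed_class:
  assumes "E \<in> sct_classes \<alpha>"
  shows "swap_closed \<alpha> E"
  using class_in_SCT[OF assms] class_closed[OF assms] swap_raising_equiv nADes_iff
  unfolding swap_closed_def by blast

lemma class_source:
  assumes E_class: "E \<in> sct_classes \<alpha>"
  obtains S where "S \<in> E" "source \<alpha> S" "\<And>T. T \<in> E \<Longrightarrow> \<exists>ws. raising_path \<alpha> S ws T"
proof -
  have source_in_E: "\<exists>S ws. S \<in> E \<and> source \<alpha> S \<and> raising_path \<alpha> S ws T" if "T \<in> E" for T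
    using raising_path_from_source[of T \<alpha>] raising_path_equiv sct_equiv_sym that
      class_in_SCT[OF E_class] class_closed[OF E_class] by (metis subsetD)
  obtain T where "T \<in> E"
    using E_class equiv_sct_equiv by (metis ex_in_conv in_quotient_imp_non_empty sct_classes_def)
  then obtain S where S_source: "S \<in> E" "source \<alpha> S"
    using source_in_E by blast
  have "\<exists>ws. raising_path \<alpha> S ws T" if "T \<in> E" for T
    using source_in_E[OF that] source_unique[OF S_source(2)]
      class_equiv[OF E_class S_source(1)] by metis
  then show thesis
    using that S_source by blast
qed

subsection \<open>Equivariant maps\<close>

definition pi_equivariant ::
  "nat list \<Rightarrow> tableau set \<Rightarrow> ((tableau \<Rightarrow>\<^sub>0 complex) \<Rightarrow> (tableau \<Rightarrow>\<^sub>0 complex)) \<Rightarrow> bool" where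
  "pi_equivariant \<alpha> E g \<longleftrightarrow> clinear g \<and> (\<forall>v\<in>formal_span E. g v \<in> formal_span E) \<and>
     (\<forall>i\<in>{1..<sum_list \<alpha>}. \<forall>v\<in>formal_span E. g (pi_op \<alpha> i v) = pi_op \<alpha> i (g v))"

lemma pi_equivariant_clinear: "pi_equivariant \<alpha> E g \<Longrightarrow> clinear g"
  by (simp add: pi_equivariant_def)

lemma pi_equivariant_pi_word:
  assumes "swap_closed \<alpha> E" "pi_equivariant \<alpha> E g" "v \<in> formal_span E"
    and "set ws \<subseteq> {1..<sum_list \<alpha>}"
  shows "g (pi_word \<alpha> ws v) = pi_word \<alpha> ws (g v)"
  using assms(4)
proof (induction ws)
  case (Cons i ws)
  then show ?case
    using assms(2) pi_word_in_formal_span[OF assms(1,3), of ws] by (simp add: pi_equivariant_def)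
qed simp

lemma module_End_S_module_equivariant:
  assumes closed: "swap_closed \<alpha> E"
    and f_End: "f \<in> module_End (hecke0 (sum_list \<alpha>)) (S_module \<alpha> E)"
  obtains g where "pi_equivariant \<alpha> E g" "f = restrict g (carrier (S_module \<alpha> E))"
proof -
  have f_ext: "f \<in> formal_span E \<rightarrow>\<^sub>E formal_span E"
    and f_add: "\<And>u v. \<lbrakk>u \<in> formal_span E; v \<in> formal_span E\<rbrakk> \<Longrightarrow> f (u + v) = f u + f v"
    using f_End by (auto simp: module_End_def)
  have f_act: "f (free_act \<alpha> p v) = free_act \<alpha> p (f v)"
    if "p \<in> carrier (free_alg (sum_list \<alpha>))" "v \<in> formal_span E" for p v
    using f_End hecke_class_closed[OF that(1)] smult_hecke_class[OF closed that(1)] that(2) f_ext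
    unfolding module_End_def by fastforce
  have f_scale: "f (cscale c v) = cscale c (f v)" if "v \<in> formal_span E" for c v
    using f_act[OF free_alg_scalar_closed that] by (simp add: free_act_scalar)
  define g where "g = lin_ext (\<lambda>T. f (basis T))"
  have g_eq: "g v = f v" if "v \<in> formal_span E" for v
    unfolding g_def using f_add f_scale that by (rule lin_ext_eq_on_formal_span)
  have "g (pi_op \<alpha> i v) = pi_op \<alpha> i (g v)" if "i \<in> {1..<sum_list \<alpha>}" "v \<in> formal_span E" for i v
    using f_act[OF free_alg_gen_closed[OF that(1)] that(2)] that(2)
      pi_op_in_formal_span[OF closed that(2)] by (simp add: g_eq free_act_gen)
  then have "pi_equivariant \<alpha> E g"
    using f_ext g_eq by (auto simp: pi_equivariant_def g_def clinear_lin_ext)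
  moreover have "f = restrict g (carrier (S_module \<alpha> E))"
    using f_ext g_eq by (auto simp: fun_eq_iff PiE_def extensional_def)
  ultimately show thesis
    by (rule that)
qed

lemma keys_pi_op_nondescent:
  assumes v_span: "v \<in> formal_span (SCT \<alpha>)" and i_range: "i \<in> {1..<sum_list \<alpha>}"
    and T_key: "T \<in> Poly_Mapping.keys (pi_op \<alpha> i v)"
  shows "i \<notin> Des \<alpha> T"
proof -
  have "pi_op \<alpha> i v \<in> formal_span {T. i \<notin> Des \<alpha> T}"
  proof (rule clinear_maps_formal_span[OF clinear_pi_op v_span])
    fix U assume U_SCT: "U \<in> SCT \<alpha>"
    have "i \<notin> Des \<alpha> (swap_entries \<alpha> i U)" if "raising (cell_of \<alpha> U i) (cell_of \<alpha> U (Suc i))"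
      using cell_of_swap_raising[OF U_SCT i_range that] raising_imp_fixing[OF that] i_range
      by (simp add: Des_iff)
    moreover have "i \<notin> Des \<alpha> U" if "i \<notin> nADes \<alpha> U" "i \<notin> ADes \<alpha> U"
      using that by (simp add: nADes_def)
    ultimately show "pi_op \<alpha> i (basis U) \<in> formal_span {T. i \<notin> Des \<alpha> T}"
      by (simp add: pi_op_basis nADes_iff[OF U_SCT] basis_in_formal_span formal.span_zero)
  qed
  then show ?thesis
    using T_key by (auto simp: formal_span_iff)
qed

lemma pi_equivariant_source_Des:
  assumes closed: "swap_closed \<alpha> E" and g_equivariant: "pi_equivariant \<alpha> E g" and S_in_E: "S \<in> E"
    and T_key: "T \<in> Poly_Mapping.keys (g (basis S))"
  shows "Des \<alpha> T \<subseteq> Des \<alpha> S"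
proof
  have S_span: "basis S \<in> formal_span E"
    using S_in_E by (rule basis_in_formal_span)
  then have "g (basis S) \<in> formal_span E"
    using g_equivariant by (simp add: pi_equivariant_def)
  then have image_SCT: "g (basis S) \<in> formal_span (SCT \<alpha>)"
    using formal_span_mono[of E "SCT \<alpha>"] closed by (auto simp: swap_closed_def)
  fix i assume i_Des: "i \<in> Des \<alpha> T"
  then have range: "i \<in> {1..<sum_list \<alpha>}"
    by (simp add: Des_iff)
  show "i \<in> Des \<alpha> S"
  proof (rule ccontr)
    assume "i \<notin> Des \<alpha> S"
    then have "pi_op \<alpha> i (basis S) = basis S"
      using range by (intro pi_op_fixing) (simp add: Des_iff)
    then have "pi_op \<alpha> i (g (basis S)) = g (basis S)"
      using g_equivariant S_span range by (metis pi_equivariant_def)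
    then show False
      using keys_pi_op_nondescent[OF image_SCT range, of T] T_key i_Des by simp
  qed
qed

lemma pi_equivariant_source_image:
  assumes E_class: "E \<in> sct_classes \<alpha>" and g_equivariant: "pi_equivariant \<alpha> E g"
    and S_source: "S \<in> E" "source \<alpha> S"
  shows "g (basis S) = cscale (Poly_Mapping.lookup (g (basis S)) S) (basis S)"
proof (rule ccontr)
  note closed = swap_closed_class[OF E_class]
  have S_span: "basis S \<in> formal_span E"
    using S_source(1) by (rule basis_in_formal_span)
  define u where "u = g (basis S) - cscale (Poly_Mapping.lookup (g (basis S)) S) (basis S)"
  assume "\<not> ?thesis"
  then have "u \<noteq> 0"
    by (simp add: u_def)
  have "u \<in> formal_span E"
    using g_equivariant S_span unfolding u_def pi_equivariant_def
    by (intro formal.span_diff formal.span_scale) auto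
  then have keys_E: "Poly_Mapping.keys u \<subseteq> E" and "u \<in> formal_span (SCT \<alpha>)"
    using class_in_SCT[OF E_class] by (auto simp: formal_span_iff)
  then obtain T where T_key: "T \<in> Poly_Mapping.keys u"
    and leading: "u \<in> formal_span (SCT_invs_le \<alpha> (card (invs \<alpha> T)))"
    using leading_tableau_exists \<open>u \<noteq> 0\<close> by metis
  have "T \<noteq> S" and "T \<in> Poly_Mapping.keys (g (basis S))"
    using T_key
    by (auto simp: u_def in_keys_iff lookup_minus lookup_single when_def split: if_splits)
  then obtain ws U where path: "raising_path \<alpha> T ws U" and kills: "pi_word \<alpha> ws (basis S) = 0"
    using source_separating_word[OF S_source(2) class_equiv[OF E_class S_source(1)]]
      pi_equivariant_source_Des[OF closed g_equivariant S_source(1)] T_key keys_E by blast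
  have "pi_word \<alpha> ws (g (basis S)) = 0"
    using pi_equivariant_pi_word[OF closed g_equivariant S_span raising_path_letters[OF path]] kills
      formal_pair.linear_0[OF pi_equivariant_clinear[OF g_equivariant]] by simp
  then have "pi_word \<alpha> ws u = 0"
    using kills unfolding u_def
    by (simp add: formal_pair.linear_diff[OF clinear_pi_word]
        formal_pair.linear_scale[OF clinear_pi_word])
  then have "Poly_Mapping.lookup u T = 0"
    using lookup_pi_word_leading[OF path leading] by simp
  then show False
    using T_key by (simp add: in_keys_iff)
qed

lemma pi_equivariant_scalar:
  assumes E_class: "E \<in> sct_classes \<alpha>" and g_equivariant: "pi_equivariant \<alpha> E g"
  obtains c where "\<And>v. v \<in> formal_span E \<Longrightarrow> g v = cscale c v"
proof -
  obtain S where S_source: "S \<in> E" "source \<alpha> S" "\<And>T. T \<in> E \<Longrightarrow> \<exists>ws. raising_path \<alpha> S ws T"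
    by (rule class_source[OF E_class]) (rule that)
  define c where "c = Poly_Mapping.lookup (g (basis S)) S"
  have "g (basis T) = cscale c (basis T)" if "T \<in> E" for T
  proof -
    obtain ws where path: "raising_path \<alpha> S ws T"
      using S_source(3) \<open>T \<in> E\<close> by blast
    have "g (basis T) = pi_word \<alpha> ws (g (basis S))"
      using pi_equivariant_pi_word[OF swap_closed_class[OF E_class] g_equivariant
          basis_in_formal_span[OF S_source(1)] raising_path_letters[OF path]]
        pi_word_raising_path[OF path] by simp
    also have "\<dots> = pi_word \<alpha> ws (cscale c (basis S))"
      using pi_equivariant_source_image[OF E_class g_equivariant S_source(1,2)]
      by (simp add: c_def)
    also have "\<dots> = cscale c (basis T)"
      by (simp add: formal_pair.linear_scale[OF clinear_pi_word] pi_word_raising_path[OF path])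
    finally show ?thesis .
  qed
  then have "g v = cscale c v" if "v \<in> formal_span E" for v
    using clinear_eq_on_formal_span[OF pi_equivariant_clinear[OF g_equivariant]
        formal.linear_scale_self that] by blast
  then show thesis
    by (rule that)
qed

subsection \<open>Endomorphisms of the class modules\<close>

lemma scalar_in_module_End:
  assumes "swap_closed \<alpha> E"
  shows "(\<lambda>v\<in>carrier (S_module \<alpha> E). cscale c v) \<in> module_End (hecke0 (sum_list \<alpha>)) (S_module \<alpha> E)"
proof -
  interpret left_module "hecke0 (sum_list \<alpha>)" "S_module \<alpha> E"
    by (rule left_module_S_module[OF assms])
  have "X \<odot>\<^bsub>S_module \<alpha> E\<^esub> cscale c v = cscale c (X \<odot>\<^bsub>S_module \<alpha> E\<^esub> v)"
    if X_carrier: "X \<in> carrier (hecke0 (sum_list \<alpha>))" and v_span: "v \<in> formal_span E" for X v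
  proof -
    obtain p where "p \<in> carrier (free_alg (sum_list \<alpha>))" "X = hecke_class (sum_list \<alpha>) p"
      using X_carrier by (rule hecke_class_cases)
    then show ?thesis
      using v_span smult_hecke_class[OF assms]
      by (simp add: formal.span_scale formal_pair.linear_scale[OF clinear_free_act])
  qed
  then show ?thesis
    using smult_closed
    by (auto simp: module_End_def formal.span_add formal.span_scale formal.scale_right_distrib)
qed

lemma module_End_S_module:
  assumes "E \<in> sct_classes \<alpha>"
  shows "module_End (hecke0 (sum_list \<alpha>)) (S_module \<alpha> E) =
    {\<lambda>v\<in>carrier (S_module \<alpha> E). cscale c v | c. c \<in> UNIV}"
proof
  show "module_End (hecke0 (sum_list \<alpha>)) (S_module \<alpha> E) \<subseteq>
    {\<lambda>v\<in>carrier (S_module \<alpha> E). cscale c v | c. c \<in> UNIV}"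
  proof
    fix f assume "f \<in> module_End (hecke0 (sum_list \<alpha>)) (S_module \<alpha> E)"
    then obtain g where g_extends: "pi_equivariant \<alpha> E g" "f = restrict g (carrier (S_module \<alpha> E))"
      using module_End_S_module_equivariant[OF swap_closed_class[OF assms]] by metis
    obtain c where "\<And>v. v \<in> formal_span E \<Longrightarrow> g v = cscale c v"
      by (rule pi_equivariant_scalar[OF assms g_extends(1)]) (rule that)
    then have "f = (\<lambda>v\<in>carrier (S_module \<alpha> E). cscale c v)"
      using g_extends(2) by (auto intro: restrict_ext)
    then show "f \<in> {\<lambda>v\<in>carrier (S_module \<alpha> E). cscale c v | c. c \<in> UNIV}"
      by blast
  qed
qed (use scalar_in_module_End[OF swap_closed_class[OF assms]] in blast)

lemma indecomposable_S_module:
  assumes E_class: "E \<in> sct_classes \<alpha>"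
  shows "indecomposable_module (hecke0 (sum_list \<alpha>)) (S_module \<alpha> E)"
proof (rule left_module.indecomposable_if_idempotents_trivial
    [OF left_module_S_module[OF swap_closed_class[OF E_class]]])
  obtain T where "T \<in> E"
    using class_source[OF E_class] by blast
  then have basis: "basis T \<in> formal_span E" "basis T \<noteq> 0"
    by (auto simp: basis_in_formal_span poly_mapping_eq_iff fun_eq_iff lookup_single)
  then show "carrier (S_module \<alpha> E) \<noteq> {\<zero>\<^bsub>S_module \<alpha> E\<^esub>}"
    by auto
  fix f assume "f \<in> module_End (hecke0 (sum_list \<alpha>)) (S_module \<alpha> E)"
    and idem: "\<And>v. v \<in> carrier (S_module \<alpha> E) \<Longrightarrow> f (f v) = f v"
  then obtain c where f_scalar: "f = (\<lambda>v\<in>carrier (S_module \<alpha> E). cscale c v)"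
    unfolding module_End_S_module[OF E_class] by blast
  have "cscale (c * c) (basis T) = cscale c (basis T)"
    using idem[of "basis T"] basis(1) by (simp add: f_scalar formal.span_scale)
  then have "c = 0 \<or> c = 1"
    using basis(2) by simp
  then show "(\<forall>v\<in>carrier (S_module \<alpha> E). f v = \<zero>\<^bsub>S_module \<alpha> E\<^esub>) \<or>
      (\<forall>v\<in>carrier (S_module \<alpha> E). f v = v)"
    by (auto simp: f_scalar)
qed

theorem theorem4p11:
  fixes n :: nat and \<alpha> :: "nat list" and E :: "tableau set"
  assumes "n \<ge> 1"
    and "\<alpha> \<in> compositions n"
    and "E \<in> sct_classes \<alpha>"
  shows "module_End (hecke0 n) (S_module \<alpha> E) =
           {\<lambda>v\<in>carrier (S_module \<alpha> E). cscale c v | c. c \<in> UNIV} \<and>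
         indecomposable_module (hecke0 n) (S_module \<alpha> E)"
proof -
  have "n = sum_list \<alpha>"
    using assms(2) by (simp add: compositions_def)
  then show ?thesis
    using module_End_S_module[OF assms(3)] indecomposable_S_module[OF assms(3)] by simp
qed

end
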